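(* Let $\Pi:\mathcal P\to\mathcal P$ be a map satisfying properties (i)–(v) listed in the context, let $\boldsymbol p\in\mathcal P$ be the underlying distribution, let $0<\alpha<1$, let $d\in\{1,2\}$, and let $\hat{\boldsymbol\phi}_n=\beta^{(L_d)}_n\Pi(\hat{\boldsymbol p}_n)+(1-\beta^{(L_d)}_n)\hat{\boldsymbol p}_n$ be the stacked estimator with mixture parameter selected by leave-one-out cross-validation with loss $L_d$. Let $q_\alpha$ and $\hat q^{\,d}_{\alpha,n}$ be the $\alpha$-quantiles of $\|\boldsymbol Y_{\boldsymbol p}\|_\infty$ and of $\|\boldsymbol Y_{\hat{\boldsymbol\phi}_n}\|_\infty$, respectively. Then $\hat q^{\,d}_{\alpha,n}$ is a strongly consistent estimator of $q_\alpha$, i.e. $\hat q^{\,d}_{\alpha,n}\to q_\alpha$ almost surely as $n\to\infty$.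
   Context: Gaussian process and quantiles. For $\boldsymbol f\in\mathcal P$, $\boldsymbol Y_{\boldsymbol f}$ is a centered Gaussian random element of $\ell_2$ with covariance operator $C$ given by $\langle C\boldsymbol e_i,\boldsymbol e_{i'}\rangle=f_i\delta_{i,i'}-f_if_{i'}$, where $(\boldsymbol e_i)$ is the standard orthonormal basis of $\ell_2$ and $\delta_{i,i'}$ the Kronecker delta. The $\alpha$-quantile $q$ of $\|\boldsymbol Y_{\boldsymbol f}\|_\infty$ is defined by $\mathbb P(\|\boldsymbol Y_{\boldsymbol f}\|_\infty>q)=\alpha$; in general take $q=\inf\{r\ge 0:\mathbb P(\|\boldsymbol Y_{\boldsymbol f}\|_\infty>r)\le\alpha\}$. For $\boldsymbol Y_{\hat{\boldsymbol\phi}_n}$ the probability is taken with the data (hence $\hat{\boldsymbol\phi}_n$) held fixed, so $\hat q^{\,d}_{\alpha,n}$ is a function of the data. Notation. $\mathcal S=\{\boldsymbol s_0,\boldsymbol s_1,\dots\}$ is a countable set, and vectors are indexed by $j\in\mathbb N=\{0,1,\dots\}$ (coordinate $j$ corresponds to $\boldsymbol s_j$). $\mathcal P=\{\boldsymbol f\in\ell_1:\ f_j\ge0,\ \sum_jf_j=1\}$. $\|\cdot\|_k$ is the $\ell_k$-norm, $\langle\cdot,\cdot\rangle$ the $\ell_2$ inner product. For real random variables $b_n$, $b_n=O_p(n^q)$ means: for every $\varepsilon>0$ there are finite $M,N>0$ with $\mathbb P(n^{-q}|b_n|>M)<\varepsilon$ for all $n>N$. Data. $\boldsymbol z_1,\boldsymbol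 z_2,\dots$ are i.i.d. $\mathcal S$-valued with p.m.f. $\boldsymbol p\in\mathcal P$. For each $n$: $x_j=\sum_{i=1}^n1\{\boldsymbol z_i=\boldsymbol s_j\}$, $t_n=\sup\{j:x_j>0\}$, $\hat p_{n,j}=x_j/n$. For $n\ge2$ and $j$ with $x_j>0$: $\hat{\boldsymbol p}^{\backslash[j]}_n=(\boldsymbol x-\boldsymbol\sigma^{[j]})/(n-1)$, where $\boldsymbol\sigma^{[j]}$ has entry $1$ at index $j$ and $0$ elsewhere, and $\hat{\boldsymbol g}^{\backslash[j]}_n=\Pi(\hat{\boldsymbol p}^{\backslash[j]}_n)$; for $j$ with $x_j=0$ put $\hat{\boldsymbol g}^{\backslash[j]}_n=0$ (irrelevant below). Mixture parameters selected by leave-one-out cross-validation. For loss $L_1$: $\beta^{(L_1)}_n=0$ if $\sum_{j=0}^{t_n}\{(x_j-n\hat g^{\backslash[j]}_{n,j})^2+(n+1)\hat g^{\backslash[j]}_{n,j}(x_j-n\hat g^{\backslash[j]}_{n,j})+n(\hat g^{\backslash[j]}_{n,j})^2\}\ge n$, and $\beta^{(L_1)}_n=1$ otherwise. For loss $L_2$: $\beta^{(L_2)}_n=b_n/a_n$ if $a_n\neq0$ and $0\le b_n\le a_n$; $\beta^{(L_2)}_n=0$ if $a_n=0$ or $b_n<0$; $\beta^{(L_2)}_n=1$ otherwise, where $$a_n=n-\sum_{j=0}^{t_n}x_j\Big\{2(x_j-\hat g^{\backslash[j]}_{n,j}(n-1))-\sum_{k=0}^{t_n}(x_k-(n-1)\hat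 g^{\backslash[j]}_{n,k})^2\Big\},$$ $$b_n=n^2-\sum_{j=0}^{t_n}x_j^2+(n-1)\sum_{j=0}^{t_n}x_j\sum_{k=0}^{t_n}x_k(\hat g^{\backslash[k]}_{n,k}-\hat g^{\backslash[j]}_{n,k}).$$ Properties assumed of $\Pi$: (i) $\Pi$ is continuous from $\ell_2$ to $\ell_2$ (i.e. on $\mathcal P$ with the $\ell_2$-norm). (ii) $\|\Pi(\boldsymbol f)-\Pi(\boldsymbol h)\|_\infty\le\|\boldsymbol f-\boldsymbol h\|_\infty$ for $\boldsymbol f,\boldsymbol h\in\mathcal P$. (iii) $\langle\Pi(\boldsymbol f),\boldsymbol f-\Pi(\boldsymbol f)\rangle=0$ and $\langle\boldsymbol f,\boldsymbol f-\Pi(\boldsymbol f)\rangle\ge0$ for every $\boldsymbol f\in\mathcal P$. (iv) There is a real sequence $c_n\to1$ such that for any frequency data $\boldsymbol x$ of size $n$, $c_n\hat{\boldsymbol\gamma}_n\le\Pi(\hat{\boldsymbol p}_n)$ coordinatewise, where $\hat\gamma_{n,j}=\Pi(\hat{\boldsymbol p}^{\backslash[j]}_n)_j$ if $x_j>0$ and $\hat\gamma_{n,j}=0$ otherwise. (v) If the true distribution satisfies $\Pi(\boldsymbol p)=\boldsymbol p$, then $n^{1/2}\|\Pi(\hat{\boldsymbol p}_n)-\boldsymbol p\|_k=O_p(1)$ for $2\le k\le\infty$, and if in addition $\sum_{j}\sqrt{p_j}<\infty$, then $n^{1/2}\|\Pi(\hat{\boldsymbol p}_n)-\boldsymbol p\|_1=O_p(1)$.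 *)

theory Defs
  imports "HOL-Probability.Probability"
begin

section \<open>Sequence spaces\<close>

text \<open>
  Real sequences are functions \<open>nat \<Rightarrow> real\<close>.  The value of \<open>lp_norm k x\<close> is meaningful only if
  \<open>x\<close> belongs to the corresponding sequence space; it is only ever applied to such sequences
  (differences of two probability vectors, and elements of \<open>ell2\<close>).
\<close>

definition lp_norm :: "ereal \<Rightarrow> (nat \<Rightarrow> real) \<Rightarrow> real" where
  "lp_norm k x =
     (if k = \<infinity> then (SUP j. \<bar>x j\<bar>)
      else (\<Sum>j. \<bar>x j\<bar> powr real_of_ereal k) powr (1 / real_of_ereal k))"

definition ell2 :: "(nat \<Rightarrow> real) set" where
  "ell2 = {x. summable (\<lambda>j. (x j)\<^sup>2)}"

definition ell2_inner :: "(nat \<Rightarrow> real) \<Rightarrow> (nat \<Rightarrow> real) \<Rightarrow> real" where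
  "ell2_inner x y = (\<Sum>j. x j * y j)"

definition unit_seq :: "nat \<Rightarrow> nat \<Rightarrow> real" where
  "unit_seq i = (\<lambda>j. of_bool (j = i))"

definition ell2_borel :: "(nat \<Rightarrow> real) measure" where
  "ell2_borel = sigma ell2
     {U. U \<subseteq> ell2 \<and> (\<forall>x\<in>U. \<exists>e>0. \<forall>y\<in>ell2. lp_norm 2 (\<lambda>j. y j - x j) < e \<longrightarrow> y \<in> U)}"

definition prob_vectors :: "(nat \<Rightarrow> real) set" where
  "prob_vectors = {f. (\<forall>j. 0 \<le> f j) \<and> f sums 1}"


section \<open>Gaussian random elements and quantiles\<close>

text \<open>The point mass at 0 counts as a (degenerate) centered Gaussian law.\<close>

definition centered_gaussian_real :: "'b measure \<Rightarrow> ('b \<Rightarrow> real) \<Rightarrow> bool" where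
  "centered_gaussian_real N X \<longleftrightarrow>
     X \<in> borel_measurable N \<and>
     ((AE \<omega> in N. X \<omega> = 0) \<or> (\<exists>\<sigma>>0. distributed N lborel X (normal_density 0 \<sigma>)))"

definition centered_gaussian_ell2 :: "'b measure \<Rightarrow> ('b \<Rightarrow> nat \<Rightarrow> real) \<Rightarrow> bool" where
  "centered_gaussian_ell2 N Y \<longleftrightarrow>
     Y \<in> measurable N ell2_borel \<and>
     (\<forall>h\<in>ell2. centered_gaussian_real N (\<lambda>\<omega>. ell2_inner (Y \<omega>) h))"

text \<open>Linearity and boundedness of \<open>C\<close> on \<open>ell2\<close> follow from the defining identity.\<close>

definition covariance_operator ::
    "'b measure \<Rightarrow> ('b \<Rightarrow> nat \<Rightarrow> real) \<Rightarrow> ((nat \<Rightarrow> real) \<Rightarrow> nat \<Rightarrow> real) \<Rightarrow> bool" where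
  "covariance_operator N Y C \<longleftrightarrow>
     (\<forall>g\<in>ell2. C g \<in> ell2 \<and>
        (\<forall>h\<in>ell2. ell2_inner (C g) h
           = (LINT \<omega>|N. ell2_inner (Y \<omega>) g * ell2_inner (Y \<omega>) h)))"

definition multinomial_gaussian ::
    "(nat \<Rightarrow> real) \<Rightarrow> 'b measure \<Rightarrow> ('b \<Rightarrow> nat \<Rightarrow> real) \<Rightarrow> bool" where
  "multinomial_gaussian f N Y \<longleftrightarrow>
     prob_space N \<and> centered_gaussian_ell2 N Y \<and>
     (\<exists>C. covariance_operator N Y C \<and>
        (\<forall>i i'. ell2_inner (C (unit_seq i)) (unit_seq i')
           = f i * of_bool (i = i') - f i * f i'))"

definition upper_quantile :: "real \<Rightarrow> 'b measure \<Rightarrow> ('b \<Rightarrow> real) \<Rightarrow> real" where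
  "upper_quantile \<alpha> N X = Inf {r. 0 \<le> r \<and> measure N {\<omega>\<in>space N. X \<omega> > r} \<le> \<alpha>}"


section \<open>Boundedness in probability\<close>

text \<open>\<open>bigO_p M q b\<close> renders \<open>b n = O\<^sub>p(n powr q)\<close>.\<close>

definition bigO_p :: "'a measure \<Rightarrow> real \<Rightarrow> (nat \<Rightarrow> 'a \<Rightarrow> real) \<Rightarrow> bool" where
  "bigO_p M q b \<longleftrightarrow>
     (\<forall>\<epsilon>>0. \<exists>K>0::real. \<exists>n0>0::nat. \<forall>n>n0.
        measure M {\<omega>\<in>space M. real n powr (- q) * \<bar>b n \<omega>\<bar> > K} < \<epsilon>)"


section \<open>Frequency data and the stacked estimator\<close>

text \<open>
  All estimators are functions of the sample size \<open>n\<close> and of the vector \<open>x\<close> of frequencies.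
\<close>

definition freq_data :: "nat \<Rightarrow> (nat \<Rightarrow> nat) \<Rightarrow> bool" where
  "freq_data n x \<longleftrightarrow> finite {j. x j > 0} \<and> (\<Sum>j | x j > 0. x j) = n"

definition freq :: "(nat \<Rightarrow> 's) \<Rightarrow> (nat \<Rightarrow> 'a \<Rightarrow> 's) \<Rightarrow> nat \<Rightarrow> 'a \<Rightarrow> nat \<Rightarrow> nat" where
  "freq s z n \<omega> = (\<lambda>j. \<Sum>i=1..n. of_bool (z i \<omega> = s j))"

definition last_index :: "(nat \<Rightarrow> nat) \<Rightarrow> nat" where
  "last_index x = Sup {j. x j > 0}"

definition emp :: "nat \<Rightarrow> (nat \<Rightarrow> nat) \<Rightarrow> nat \<Rightarrow> real" where
  "emp n x = (\<lambda>j. real (x j) / real n)"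

definition emp_loo :: "nat \<Rightarrow> (nat \<Rightarrow> nat) \<Rightarrow> nat \<Rightarrow> nat \<Rightarrow> real" where
  "emp_loo n x j = (\<lambda>k. (real (x k) - unit_seq j k) / (real n - 1))"

text \<open>\<open>g_loo \<Psi> n x j k\<close> is the \<open>k\<close>-th entry of the estimator leaving out one observation of
  category \<open>j\<close>.\<close>

definition g_loo :: "((nat \<Rightarrow> real) \<Rightarrow> nat \<Rightarrow> real) \<Rightarrow> nat \<Rightarrow> (nat \<Rightarrow> nat) \<Rightarrow> nat \<Rightarrow> nat \<Rightarrow> real" where
  "g_loo \<Psi> n x j = (if x j > 0 then \<Psi> (emp_loo n x j) else (\<lambda>_. 0))"

definition gamma_hat :: "((nat \<Rightarrow> real) \<Rightarrow> nat \<Rightarrow> real) \<Rightarrow> nat \<Rightarrow> (nat \<Rightarrow> nat) \<Rightarrow> nat \<Rightarrow> real" where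
  "gamma_hat \<Psi> n x = (\<lambda>j. if x j > 0 then \<Psi> (emp_loo n x j) j else 0)"

definition beta_L1 :: "((nat \<Rightarrow> real) \<Rightarrow> nat \<Rightarrow> real) \<Rightarrow> nat \<Rightarrow> (nat \<Rightarrow> nat) \<Rightarrow> real" where
  "beta_L1 \<Psi> n x =
     (let g = g_loo \<Psi> n x in
      if (\<Sum>j=0..last_index x.
            (real (x j) - real n * g j j)\<^sup>2
            + (real n + 1) * g j j * (real (x j) - real n * g j j)
            + real n * (g j j)\<^sup>2) \<ge> real n
      then 0 else 1)"

definition a_L2 :: "((nat \<Rightarrow> real) \<Rightarrow> nat \<Rightarrow> real) \<Rightarrow> nat \<Rightarrow> (nat \<Rightarrow> nat) \<Rightarrow> real" where
  "a_L2 \<Psi> n x =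
     (let g = g_loo \<Psi> n x; t = last_index x in
      real n - (\<Sum>j=0..t. real (x j) *
        (2 * (real (x j) - g j j * (real n - 1))
         - (\<Sum>k=0..t. (real (x k) - (real n - 1) * g j k)\<^sup>2))))"

definition b_L2 :: "((nat \<Rightarrow> real) \<Rightarrow> nat \<Rightarrow> real) \<Rightarrow> nat \<Rightarrow> (nat \<Rightarrow> nat) \<Rightarrow> real" where
  "b_L2 \<Psi> n x =
     (let g = g_loo \<Psi> n x; t = last_index x in
      (real n)\<^sup>2 - (\<Sum>j=0..t. (real (x j))\<^sup>2)
      + (real n - 1) * (\<Sum>j=0..t. real (x j) * (\<Sum>k=0..t. real (x k) * (g k k - g j k))))"

definition beta_L2 :: "((nat \<Rightarrow> real) \<Rightarrow> nat \<Rightarrow> real) \<Rightarrow> nat \<Rightarrow> (nat \<Rightarrow> nat) \<Rightarrow> real" where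
  "beta_L2 \<Psi> n x =
     (let a = a_L2 \<Psi> n x; b = b_L2 \<Psi> n x in
      if a \<noteq> 0 \<and> 0 \<le> b \<and> b \<le> a then b / a
      else if a = 0 \<or> b < 0 then 0
      else 1)"

text \<open>The index \<open>d \<in> {1, 2}\<close> selects the loss.\<close>

definition mixture_param ::
    "nat \<Rightarrow> ((nat \<Rightarrow> real) \<Rightarrow> nat \<Rightarrow> real) \<Rightarrow> nat \<Rightarrow> (nat \<Rightarrow> nat) \<Rightarrow> real" where
  "mixture_param d \<Psi> n x = (if d = 1 then beta_L1 \<Psi> n x else beta_L2 \<Psi> n x)"

definition stacked ::
    "nat \<Rightarrow> ((nat \<Rightarrow> real) \<Rightarrow> nat \<Rightarrow> real) \<Rightarrow> nat \<Rightarrow> (nat \<Rightarrow> nat) \<Rightarrow> nat \<Rightarrow> real" where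
  "stacked d \<Psi> n x =
     (\<lambda>j. mixture_param d \<Psi> n x * \<Psi> (emp n x) j + (1 - mixture_param d \<Psi> n x) * emp n x j)"

end

theory Submission
  imports Defs "HOL-Real_Asymp.Real_Asymp"
begin

text \<open>
  The empirical frequencies converge to \<open>p\<close> in \<open>\<ell>\<^sub>1\<close> almost surely (Hoeffding, Borel--Cantelli,
  Scheffe).  If \<open>\<Psi> p = p\<close>, every mixture of \<open>\<Psi> (emp n x)\<close> and \<open>emp n x\<close> converges to \<open>p\<close> since
  \<open>\<Psi>\<close> is a sup-norm contraction.  Otherwise \<open>\<langle>p, p - \<Psi> p\<rangle> = \<parallel>p - \<Psi> p\<parallel>\<^sup>2 > 0\<close>, and this drives
  the mixture parameter to 0: the \<open>L\<^sub>1\<close> criterion grows like \<open>n\<^sup>2\<close>, while \<open>a\<^sub>n\<close> grows like \<open>n\<^sup>3\<close> and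
  \<open>b\<^sub>n \<le> 2 n\<^sup>2\<close>.

  For the quantiles, expectations of trigonometric polynomials of finitely many coordinates are
  continuous in the covariance, hence so are expectations of Lipschitz functions of the sup norm.
  It remains to see that the distribution function of \<open>\<parallel>Y\<^sub>p\<parallel>\<close> is not flat at level \<open>1 - \<alpha>\<close>: a gap
  in the law of the norm forces a zero-one law, by rotating \<open>Y\<^sub>p\<close> into an independent copy.
\<close>

section \<open>Uniform closure of trigonometric polynomials\<close>

text \<open>The Gaussian elements attached to the estimates and to \<open>p\<close> live on
  unrelated probability spaces, so nothing can be coupled and only laws are compared. What is
  retained of a law is its cosine expectations and a bound on its second moments, a class that also
  admits rotated pairs of copies. The sup norm depends on infinitely many coordinates, so its
  reduction to finitely many must be uniform in \<open>n\<close>. The error beyond \<open>J\<close>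
  is controlled by \<open>1 - (\<Sum>j<J. f j)\<close>; as total masses are 1, this quantity
  converges as soon as the coordinates do. Hence coordinatewise convergence of the stacked estimator
  suffices. Convergence in distribution moves quantiles correctly only where the limiting
  distribution function is not flat, and the law of the norm has no explicit form; a qualitative
  argument has to exclude flat stretches. On the statistical side, the leave-one-out vectors vary
  with the omitted category, and the number of observed categories may grow without bound. The
  sup-norm contraction makes their error uniform over categories, and \<open>\<ell>\<^sub>1\<close>
  convergence allows sums over all categories to be weighted by \<open>p\<close> instead of the
  observed frequencies.\<close>

inductive_set trig :: "nat \<Rightarrow> ((nat \<Rightarrow> real) \<Rightarrow> real) set" for J where
  wave: "(\<lambda>y. cos (c + (\<Sum>j<J. h j * y j))) \<in> trig J"
| add: "f \<in> trig J \<Longrightarrow> g \<in> trig J \<Longrightarrow> (\<lambda>y. f y + g y) \<in> trig J"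
| scale: "f \<in> trig J \<Longrightarrow> (\<lambda>y. a * f y) \<in> trig J"

text \<open>The product-to-sum formula turns a product of two waves into a sum of two waves. The
  free phase lets cosines alone cover sines, and constants through \<open>h = 0\<close>, so the span
  is an algebra.\<close>

lemma trig_mult_wave:
  assumes "g \<in> trig J"
  shows "(\<lambda>y. cos (c + (\<Sum>j<J. h j * y j)) * g y) \<in> trig J"
  using assms
proof induction
  case (wave c' h')
  have "(\<lambda>y. cos (c + (\<Sum>j<J. h j * y j)) * cos (c' + (\<Sum>j<J. h' j * y j))) =
    (\<lambda>y. (1/2) * (cos ((c - c') + (\<Sum>j<J. (h j - h' j) * y j))
               + cos ((c + c') + (\<Sum>j<J. (h j + h' j) * y j))))"
    by (simp add: cos_times_cos algebra_simps sum.distrib sum_subtractf add_divide_distrib)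
  moreover have "\<dots> \<in> trig J" by (intro trig.scale trig.add trig.wave)
  ultimately show ?case by simp
next
  case (add f g)
  then show ?case by (simp add: distrib_left trig.add)
next
  case (scale f a)
  from trig.scale[OF scale.IH, of a] show ?case by (simp add: mult.left_commute)
qed

lemma trig_mult:
  assumes "f \<in> trig J" "g \<in> trig J"
  shows "(\<lambda>y. f y * g y) \<in> trig J"
  using assms(1)
proof induction
  case (wave c h)
  show ?case by (rule trig_mult_wave[OF assms(2)])
next
  case (add f g)
  then show ?case by (simp add: distrib_right trig.add)
next
  case (scale f a)
  from trig.scale[OF scale.IH, of a] show ?case by (simp add: mult.assoc)
qed

lemma trig_bounded: "f \<in> trig J \<Longrightarrow> \<exists>B. \<forall>y. \<bar>f y\<bar> \<le> B"
proof (induction rule: trig.induct)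
  case (wave c h)
  show ?case by (rule exI[of _ 1]) simp
next
  case (add f g)
  then obtain B C where "\<forall>y. \<bar>f y\<bar> \<le> B" "\<forall>y. \<bar>g y\<bar> \<le> C" by blast
  then show ?case by (intro exI[of _ "B + C"]) (meson abs_triangle_ineq add_mono order_trans)
next
  case (scale f a)
  then obtain B where "\<forall>y. \<bar>f y\<bar> \<le> B" by blast
  then show ?case by (intro exI[of _ "\<bar>a\<bar> * B"]) (simp add: abs_mult mult_left_mono)
qed

text \<open>Approximation is uniform over all sequences at once, not on bounded sets. Members are
  therefore bounded functions; a coordinate \<open>y k\<close> is not among them, and
  \<open>R * sin (y k / R)\<close> has to take its place.\<close>

definition trig_closure :: "nat \<Rightarrow> ((nat \<Rightarrow> real) \<Rightarrow> real) set" where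
  "trig_closure J = {g. \<forall>e>0. \<exists>t\<in>trig J. \<forall>y. \<bar>g y - t y\<bar> \<le> e}"

lemma trig_closureI: "g \<in> trig J \<Longrightarrow> g \<in> trig_closure J"
  unfolding trig_closure_def by (auto intro!: bexI[of _ g])

lemma trig_closure_const: "(\<lambda>y. c) \<in> trig_closure J"
  using trig.scale[OF trig.wave[of 0 "\<lambda>_. 0"], of c] by (auto intro: trig_closureI)

lemma trig_closure_bounded:
  assumes "f \<in> trig_closure J" shows "\<exists>B>0. \<forall>y. \<bar>f y\<bar> \<le> B"
proof -
  obtain t where t: "t \<in> trig J" "\<forall>y. \<bar>f y - t y\<bar> \<le> 1"
    using assms unfolding trig_closure_def by (force dest: spec[of _ 1])
  obtain B where B: "\<forall>y. \<bar>t y\<bar> \<le> B" using trig_bounded[OF t(1)] by blast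
  have "\<bar>f y\<bar> \<le> \<bar>B\<bar> + 1" for y using t(2)[rule_format, of y] B[rule_format, of y] by linarith
  then show ?thesis by (intro exI[of _ "\<bar>B\<bar> + 1"]) auto
qed

lemma trig_closure_add:
  assumes f: "f \<in> trig_closure J" and g: "g \<in> trig_closure J"
  shows "(\<lambda>y. f y + g y) \<in> trig_closure J"
  unfolding trig_closure_def
proof safe
  fix e :: real assume "e > 0"
  then have "e/2 > 0" by simp
  obtain t where t: "t \<in> trig J" "\<forall>y. \<bar>f y - t y\<bar> \<le> e/2"
    using f \<open>e/2 > 0\<close> unfolding trig_closure_def by blast
  obtain u where u: "u \<in> trig J" "\<forall>y. \<bar>g y - u y\<bar> \<le> e/2"
    using g \<open>e/2 > 0\<close> unfolding trig_closure_def by blast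
  have "\<bar>f y + g y - (t y + u y)\<bar> \<le> e" for y
    using t(2)[rule_format, of y] u(2)[rule_format, of y] by linarith
  then show "\<exists>t\<in>trig J. \<forall>y. \<bar>f y + g y - t y\<bar> \<le> e"
    using trig.add[OF t(1) u(1)] by (intro bexI[of _ "\<lambda>y. t y + u y"]) auto
qed

lemma trig_closure_mult:
  assumes f: "f \<in> trig_closure J" and g: "g \<in> trig_closure J"
  shows "(\<lambda>y. f y * g y) \<in> trig_closure J"
  unfolding trig_closure_def
proof safe
  fix e :: real assume e: "e > 0"
  obtain B where B: "B > 0" "\<And>y. \<bar>f y\<bar> \<le> B" using trig_closure_bounded[OF f] by blast
  have "e / (2 * B) > 0" using e B by simp
  \<comment> \<open>The bound \<open>D\<close> of \<open>u\<close> becomes available only after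
    \<open>u\<close> is chosen, so the accuracy for \<open>f\<close> is fixed last.\<close>
  then obtain u where u: "u \<in> trig J" "\<And>y. \<bar>g y - u y\<bar> \<le> e / (2 * B)"
    using g unfolding trig_closure_def by blast
  obtain D where D: "D > 0" "\<And>y. \<bar>u y\<bar> \<le> D" 
    using trig_closure_bounded[OF trig_closureI[OF u(1)]] by blast
  have "e / (2 * D) > 0" using e D by simp
  then obtain t where t: "t \<in> trig J" "\<And>y. \<bar>f y - t y\<bar> \<le> e / (2 * D)"
    using f unfolding trig_closure_def by blast
  have "\<bar>f y * g y - t y * u y\<bar> \<le> e" for y
  proof -
    have "f y * g y - t y * u y = f y * (g y - u y) + u y * (f y - t y)"
      by (simp add: algebra_simps)
    then have "\<bar>f y * g y - t y * u y\<bar> \<le> \<bar>f y\<bar> * \<bar>g y - u y\<bar> + \<bar>u y\<bar> * \<bar>f y - t y\<bar>"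
      by (simp flip: abs_mult)
    also have "\<dots> \<le> B * (e / (2 * B)) + D * (e / (2 * D))"
      using B D u(2) t(2) by (intro add_mono mult_mono) auto
    also have "\<dots> = e" using B D by simp
    finally show ?thesis .
  qed
  then show "\<exists>t\<in>trig J. \<forall>y. \<bar>f y * g y - t y\<bar> \<le> e"
    using trig_mult[OF t(1) u(1)] by (intro bexI[of _ "\<lambda>y. t y * u y"]) auto
qed

lemma trig_closure_polynomial:
  fixes P :: "real \<Rightarrow> real"
  assumes "real_polynomial_function P" and f: "f \<in> trig_closure J"
  shows "(\<lambda>y. P (f y)) \<in> trig_closure J"
  using assms(1)
proof induction
  case (linear P)
  then obtain c where "\<And>x. P x = x * c" by (auto simp: real_bounded_linear)
  then show ?case by (simp add: trig_closure_mult trig_closure_const f)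
qed (auto intro: trig_closure_const trig_closure_add trig_closure_mult)

text \<open>\<open>f\<close> takes its values in one compact interval, so Weierstrass approximation
  of \<open>\<psi>\<close> there is uniform in \<open>y\<close>.\<close>

lemma trig_closure_continuous:
  fixes \<psi> :: "real \<Rightarrow> real"
  assumes cont: "continuous_on UNIV \<psi>" and f: "f \<in> trig_closure J"
  shows "(\<lambda>y. \<psi> (f y)) \<in> trig_closure J"
  unfolding trig_closure_def
proof safe
  fix e :: real assume "e > 0"
  then have e: "e / 2 > 0" by simp
  obtain B where B: "B > 0" "\<And>y. \<bar>f y\<bar> \<le> B" using trig_closure_bounded[OF f] by blast
  obtain P where P: "real_polynomial_function P" "\<And>x. x \<in> {-B..B} \<Longrightarrow> \<bar>\<psi> x - P x\<bar> < e / 2"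
    by (rule Stone_Weierstrass_real_polynomial_function
        [OF compact_Icc continuous_on_subset[OF cont subset_UNIV] e]) iprover
  obtain t where t: "t \<in> trig J" "\<And>y. \<bar>P (f y) - t y\<bar> \<le> e / 2"
    using trig_closure_polynomial[OF P(1) f, unfolded trig_closure_def mem_Collect_eq, rule_format, OF e]
    by blast
  have "\<bar>\<psi> (f y) - t y\<bar> \<le> e" for y
  proof -
    have "f y \<in> {-B..B}" using B(2)[of y] by auto
    then have "\<bar>\<psi> (f y) - P (f y)\<bar> < e / 2" using P(2) by blast
    then show ?thesis using t(2)[of y] by linarith
  qed
  then show "\<exists>t\<in>trig J. \<forall>y. \<bar>\<psi> (f y) - t y\<bar> \<le> e" using t(1) by blast
qed

lemma trig_closure_max:
  assumes f: "f \<in> trig_closure J" and g: "g \<in> trig_closure J"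
  shows "(\<lambda>y. max (f y) (g y)) \<in> trig_closure J"
proof -
  have *: "(\<lambda>y. c * h y) \<in> trig_closure J" if "h \<in> trig_closure J" for c h
    by (intro trig_closure_mult trig_closure_const that)
  have "(\<lambda>y. \<bar>f y + (-1) * g y\<bar>) \<in> trig_closure J"
    by (rule trig_closure_continuous[of abs, OF _ trig_closure_add[OF f *[OF g]]]) (intro continuous_intros)
  then have "(\<lambda>y. (1/2) * ((f y + g y) + \<bar>f y + (-1) * g y\<bar>)) \<in> trig_closure J"
    by (rule *[OF trig_closure_add[OF trig_closure_add[OF f g]]])
  moreover have "(\<lambda>y. (1/2) * ((f y + g y) + \<bar>f y + (-1) * g y\<bar>)) = (\<lambda>y. max (f y) (g y))"
    by (auto simp: max_def)
  ultimately show ?thesis by simp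
qed

section \<open>Finite sections of the sup norm and their almost periodic approximation\<close>

primrec max_abs :: "nat \<Rightarrow> (nat \<Rightarrow> real) \<Rightarrow> real" where
  "max_abs 0 y = 0"
| "max_abs (Suc k) y = max (max_abs k y) \<bar>y k\<bar>"

text \<open>The phase \<open>- pi / 2\<close> and the frequency \<open>1 / R\<close> at coordinate
  \<open>k\<close> alone turn a wave into \<open>sin (y k / R)\<close>; absolute values and maxima
  then stay in the closure.\<close>

lemma max_abs_sin_trig_closure:
  assumes "k \<le> J"
  shows "(\<lambda>y. max_abs k (\<lambda>j. R * sin (y j / R))) \<in> trig_closure J"
  using assms
proof (induction k)
  case 0
  then show ?case by (simp add: trig_closure_const)
next
  case (Suc k)
  have "(\<lambda>y. cos (- (pi/2) + (\<Sum>j<J. (of_bool (j = k) / R) * y j))) \<in> trig_closure J"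
    by (intro trig_closureI trig.wave)
  also have "(\<lambda>y. cos (- (pi/2) + (\<Sum>j<J. (of_bool (j = k) / R) * y j))) = (\<lambda>y. sin (y k / R))"
  proof
    fix y :: "nat \<Rightarrow> real"
    have "(\<Sum>j<J. (of_bool (j = k) / R) * y j) = (\<Sum>j<J. if j = k then y j / R else 0)"
      by (intro sum.cong) auto
    also have "\<dots> = y k / R" using Suc.prems by simp
    finally show "cos (- (pi/2) + (\<Sum>j<J. (of_bool (j = k) / R) * y j)) = sin (y k / R)"
      unfolding sin_cos_eq by (simp add: cos_diff cos_add)
  qed
  finally have "(\<lambda>y. \<bar>R * sin (y k / R)\<bar>) \<in> trig_closure J"
    by (rule trig_closure_continuous[rotated]) (intro continuous_intros)
  then show ?case using Suc by (auto intro: trig_closure_max)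
qed

lemma max_abs_nonneg: "0 \<le> max_abs k y"
  by (induction k) auto

text \<open>A sum rather than a maximum stands on the right: it can be integrated term by term
  against second moments, whose total is bounded independently of \<open>k\<close>.\<close>

lemma max_abs_diff_le: "\<bar>max_abs k x - max_abs k y\<bar> \<le> (\<Sum>j<k. \<bar>x j - y j\<bar>)"
proof (induction k)
  case (Suc k)
  have le: "max a b \<le> max c d + (\<bar>a - c\<bar> + \<bar>b - d\<bar>)" for a b c d :: real
  proof (rule max.boundedI)
    have "a \<le> c + (\<bar>a - c\<bar> + \<bar>b - d\<bar>)" "b \<le> d + (\<bar>a - c\<bar> + \<bar>b - d\<bar>)" by linarith+
    then show "a \<le> max c d + (\<bar>a - c\<bar> + \<bar>b - d\<bar>)" "b \<le> max c d + (\<bar>a - c\<bar> + \<bar>b - d\<bar>)"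
      by (meson add_right_mono max.cobounded1 max.cobounded2 order_trans)+
  qed
  have "\<bar>max a b - max c d\<bar> \<le> \<bar>a - c\<bar> + \<bar>b - d\<bar>" for a b c d :: real
  proof (rule abs_leI)
    show "max a b - max c d \<le> \<bar>a - c\<bar> + \<bar>b - d\<bar>"
      using le[of a b c d] by (simp only: diff_le_eq add.commute)
    show "- (max a b - max c d) \<le> \<bar>a - c\<bar> + \<bar>b - d\<bar>"
      using le[of c d a b]
      by (simp only: minus_diff_eq diff_le_eq add.commute abs_minus_commute[of c a] abs_minus_commute[of d b])
  qed
  then have "\<bar>max_abs (Suc k) x - max_abs (Suc k) y\<bar>
      \<le> \<bar>max_abs k x - max_abs k y\<bar> + \<bar>\<bar>x k\<bar> - \<bar>y k\<bar>\<bar>" by simp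
  also have "\<dots> \<le> (\<Sum>j<k. \<bar>x j - y j\<bar>) + \<bar>x k - y k\<bar>"
    by (intro add_mono Suc abs_triangle_ineq3)
  finally show ?case by simp
qed simp

text \<open>Trades a first-order quantity for a second moment: either
  \<open>\<bar>w\<bar> \<le> e\<close>, or \<open>\<bar>w\<bar>\<close> is below
  \<open>w\<^sup>2 / e\<close>.\<close>

lemma le_add_square_div: 
  fixes e w :: real assumes "e > 0" shows "\<bar>w\<bar> \<le> e + w\<^sup>2 / e"
proof (cases "\<bar>w\<bar> \<le> e")
  case True
  then show ?thesis using assms by (simp add: add_increasing2)
next
  case False
  then have "\<bar>w\<bar> * e \<le> \<bar>w\<bar> * \<bar>w\<bar>" by (intro mult_left_mono) auto
  then have "\<bar>w\<bar> \<le> w\<^sup>2 / e" using assms by (simp add: field_simps power2_eq_square flip: abs_mult)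
  then show ?thesis using assms by simp
qed

text \<open>The slack \<open>e\<close> is paid once and not once per coordinate, because a new
  coordinate raises a maximum at most to its own absolute value.\<close>

lemma max_abs_tail:
  assumes "e > 0" "J \<le> K"
  shows "\<bar>max_abs K y - max_abs J y\<bar> \<le> e + (\<Sum>j=J..<K. (y j)\<^sup>2 / e)"
  using assms(2)
proof (induction rule: dec_induct)
  case base
  then show ?case using assms by simp
next
  case (step K)
  have mono: "max_abs J y \<le> max_abs K y" using step.hyps(1)
    by (induction rule: dec_induct) auto
  have nn: "0 \<le> (\<Sum>j=J..<K. (y j)\<^sup>2 / e)" "0 \<le> (y K)\<^sup>2 / e"
    using assms by (auto intro!: sum_nonneg)
  have "(\<Sum>j=J..<Suc K. (y j)\<^sup>2 / e) = (\<Sum>j=J..<K. (y j)\<^sup>2 / e) + (y K)\<^sup>2 / e"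
    using step.hyps by simp
  then show ?case using step.IH mono nn le_add_square_div[OF assms(1), of "y K"] max_abs_nonneg[of J y]
    unfolding max_abs.simps by linarith
qed

lemma abs_le_lp_norm_inf:
  assumes "bdd_above (range (\<lambda>j. \<bar>y j\<bar>))"
  shows "\<bar>y j\<bar> \<le> lp_norm \<infinity> y"
  using assms by (auto simp: lp_norm_def intro: cSUP_upper)

lemma lp_norm_inf_le: "(\<And>j. \<bar>y j\<bar> \<le> B) \<Longrightarrow> lp_norm \<infinity> y \<le> B"
  by (auto simp: lp_norm_def intro: cSUP_least)

lemma max_abs_tendsto:
  assumes "bdd_above (range (\<lambda>j. \<bar>y j\<bar>))"
  shows "(\<lambda>k. max_abs k y) \<longlonglongrightarrow> lp_norm \<infinity> y"
proof -
  have le: "max_abs k y \<le> lp_norm \<infinity> y" for k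
    using abs_le_lp_norm_inf[OF assms] abs_ge_zero[THEN order_trans[OF _ abs_le_lp_norm_inf[OF assms, of 0]]]
    by (induction k) auto
  have mono: "max_abs j y \<le> max_abs k y" if "j \<le> k" for j k
    using that by (induction rule: dec_induct) auto
  show ?thesis
  proof (rule increasing_tendsto)
    fix x assume "x < lp_norm \<infinity> y"
    then obtain j where "x < \<bar>y j\<bar>"
      unfolding lp_norm_def using less_cSUP_iff[OF _ assms] by auto
    then have "x < max_abs k y" if "Suc j \<le> k" for k
      using mono[OF that] by auto
    then show "\<forall>\<^sub>F k in sequentially. x < max_abs k y"
      unfolding eventually_sequentially by blast
  qed (simp add: le)
qed

text \<open>The Taylor remainder is taken of order two although a cubic one exists: the processes
  below come with second moments only.\<close>

lemma abs_scaled_sin_diff_le: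
  fixes R w :: real assumes "R > 0" shows "\<bar>R * sin (w / R) - w\<bar> \<le> w\<^sup>2 / (2 * R)"
proof -
  have "\<bar>sin (w/R) - (\<Sum>m<2. sin_coeff m * (w/R) ^ m)\<bar> \<le> inverse (fact 2) * \<bar>w/R\<bar> ^ 2"
    by (rule Maclaurin_sin_bound)
  then have "\<bar>sin (w/R) - w/R\<bar> \<le> (w/R)\<^sup>2 / 2"
    by (simp add: sin_coeff_def eval_nat_numeral field_simps)
  then have "R * \<bar>sin (w/R) - w/R\<bar> \<le> R * ((w/R)\<^sup>2 / 2)"
    using assms by (intro mult_left_mono) auto
  moreover have "R * sin (w/R) - w = R * (sin (w/R) - w/R)"
    using assms by (simp add: algebra_simps)
  then have "\<bar>R * sin (w/R) - w\<bar> = R * \<bar>sin (w/R) - w/R\<bar>"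
    using assms by (simp add: abs_mult)
  moreover have "R * ((w/R)\<^sup>2 / 2) = w\<^sup>2 / (2 * R)"
    using assms by (simp add: power2_eq_square)
  ultimately show ?thesis by simp
qed

section \<open>Weak continuity of the sup norm\<close>

text \<open>The quadratic form of the covariance operator, that is, the variance of the sum of
  \<open>h j * Y j\<close> over \<open>j < J\<close>.\<close>

definition multinomial_variance :: "(nat \<Rightarrow> real) \<Rightarrow> nat \<Rightarrow> (nat \<Rightarrow> real) \<Rightarrow> real" where
  "multinomial_variance f J h =
     (\<Sum>i<J. \<Sum>k<J. h i * h k * (f i * of_bool (i = k) - f i * f k))"

text \<open>The law enters only through the expectations of cosines (\<open>c = - \<pi> / 2\<close> gives sines).
  The slack factor 2 in the second moments lets rotations of two independent copies qualify
  by the Cauchy--Schwarz inequality alone.\<close>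

definition multinomial_process :: "(nat \<Rightarrow> real) \<Rightarrow> 'b measure \<Rightarrow> ('b \<Rightarrow> nat \<Rightarrow> real) \<Rightarrow> bool" where
  "multinomial_process f Q W \<longleftrightarrow>
     prob_space Q \<and> (\<forall>j. (\<lambda>\<omega>. W \<omega> j) \<in> borel_measurable Q) \<and>
     (\<forall>\<omega>\<in>space Q. bdd_above (range (\<lambda>j. \<bar>W \<omega> j\<bar>))) \<and>
     (\<forall>j. integrable Q (\<lambda>\<omega>. (W \<omega> j)\<^sup>2) \<and> (\<integral>\<omega>. (W \<omega> j)\<^sup>2 \<partial>Q) \<le> 2 * f j) \<and>
     (\<forall>J c h. (\<integral>\<omega>. cos (c + (\<Sum>j<J. h j * W \<omega> j)) \<partial>Q) =
        cos c * exp (- multinomial_variance f J h / 2))"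

lemma multinomial_process_prob_space: "multinomial_process f Q W \<Longrightarrow> prob_space Q"
  unfolding multinomial_process_def by blast

lemma multinomial_process_cos:
  "multinomial_process f Q W \<Longrightarrow>
   (\<integral>\<omega>. cos (c + (\<Sum>j<J. h j * W \<omega> j)) \<partial>Q) = cos c * exp (- multinomial_variance f J h / 2)"
  unfolding multinomial_process_def by blast

lemma multinomial_variance_tendsto:
  assumes "\<And>j. (\<lambda>n. f n j) \<longlonglongrightarrow> g j"
  shows "(\<lambda>n. multinomial_variance (f n) J h) \<longlonglongrightarrow> multinomial_variance g J h"
  unfolding multinomial_variance_def by (intro tendsto_intros assms)

context
  fixes f Q and W :: "'b \<Rightarrow> nat \<Rightarrow> real"
  assumes mp: "multinomial_process f Q W"
begin

interpretation prob_space Q using mp by (rule multinomial_process_prob_space)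

lemma multinomial_process_measurable [measurable]: "(\<lambda>\<omega>. W \<omega> j) \<in> borel_measurable Q"
  using mp by (simp add: multinomial_process_def)

lemma multinomial_process_bdd: "\<omega> \<in> space Q \<Longrightarrow> bdd_above (range (\<lambda>j. \<bar>W \<omega> j\<bar>))"
  using mp by (simp add: multinomial_process_def)

lemma multinomial_process_second_moment:
  "integrable Q (\<lambda>\<omega>. (W \<omega> j)\<^sup>2)" "(\<integral>\<omega>. (W \<omega> j)\<^sup>2 \<partial>Q) \<le> 2 * f j"
  using mp by (simp_all add: multinomial_process_def)

lemma borel_measurable_trig: "t \<in> trig J \<Longrightarrow> (\<lambda>\<omega>. t (W \<omega>)) \<in> borel_measurable Q"
  by (induction rule: trig.induct) (measurable, auto)

lemma integrable_trig: 
  assumes "t \<in> trig J" shows "integrable Q (\<lambda>\<omega>. t (W \<omega>))"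
proof -
  obtain B where "\<And>y. \<bar>t y\<bar> \<le> B" using trig_bounded[OF assms] by blast
  then show ?thesis
    by (intro integrable_const_bound[where B = B] borel_measurable_trig[OF assms]) auto
qed

lemma borel_measurable_max_abs [measurable]: "(\<lambda>\<omega>. max_abs k (W \<omega>)) \<in> borel_measurable Q"
  by (induction k) auto

lemma borel_measurable_max_abs_sin [measurable]:
  "(\<lambda>\<omega>. max_abs k (\<lambda>j. R * sin (W \<omega> j / R))) \<in> borel_measurable Q"
  by (induction k) auto

lemma borel_measurable_lp_norm_inf [measurable]:
  "(\<lambda>\<omega>. lp_norm \<infinity> (W \<omega>)) \<in> borel_measurable Q"
  by (rule borel_measurable_LIMSEQ_real[of _ "\<lambda>k \<omega>. max_abs k (W \<omega>)"])
     (auto intro: max_abs_tendsto multinomial_process_bdd)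

text \<open>Truncation to \<open>J\<close> coordinates and replacing \<open>w\<close> by the almost periodic \<open>R sin (w / R)\<close>
  changes expectations by an amount controlled through second moments only.\<close>

lemma truncation_bound:
  fixes \<psi> :: "real \<Rightarrow> real"
  assumes lip: "\<And>x y. \<bar>\<psi> x - \<psi> y\<bar> \<le> L * \<bar>x - y\<bar>" and bdd: "\<And>x. \<bar>\<psi> x\<bar> \<le> B"
    and f: "f \<in> prob_vectors" and "e > 0" "R > 0" "L \<ge> 0"
  shows "\<bar>(\<integral>\<omega>. \<psi> (lp_norm \<infinity> (W \<omega>)) \<partial>Q) - (\<integral>\<omega>. \<psi> (max_abs J (\<lambda>j. R * sin (W \<omega> j / R))) \<partial>Q)\<bar>
         \<le> L * (e + 2 * (1 - (\<Sum>j<J. f j)) / e + 1 / R)"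
proof -
  have fs: "f sums 1" "\<And>j. f j \<ge> 0" using f by (auto simp: prob_vectors_def)
  have part: "(\<Sum>j<K. f j) \<le> 1" for K
    using sum_le_suminf[of f "{..<K}"] fs by (auto simp: sums_iff)
  have "L-lipschitz_on UNIV \<psi>"
    using lip \<open>L \<ge> 0\<close> by (auto simp: lipschitz_on_def dist_real_def)
  then have cont: "continuous_on UNIV \<psi>" by (rule lipschitz_on_continuous_on)
  then have "\<psi> \<in> borel_measurable borel" by (rule borel_measurable_continuous_onI)
  note this [measurable]
  have int: "integrable Q (\<lambda>\<omega>. \<psi> (X \<omega>))" if [measurable]: "X \<in> borel_measurable Q" for X
    by (rule integrable_const_bound[where B = B]) (auto simp: bdd)
  let ?S = "\<lambda>\<omega>. max_abs J (\<lambda>j. R * sin (W \<omega> j / R))"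
  \<comment> \<open>The full norm is first replaced by a section of length \<open>K\<close>, which
    keeps all sums finite. The bound is free of \<open>K\<close> and survives the limit by dominated
    convergence.\<close>
  have bound: "\<bar>(\<integral>\<omega>. \<psi> (max_abs K (W \<omega>)) \<partial>Q) - (\<integral>\<omega>. \<psi> (?S \<omega>) \<partial>Q)\<bar>
      \<le> L * (e + 2 * (1 - (\<Sum>j<J. f j)) / e + 1 / R)" if "J \<le> K" for K
  proof -
    let ?D = "\<lambda>\<omega>. L * (e + (\<Sum>j=J..<K. (W \<omega> j)\<^sup>2 / e) + (\<Sum>j<J. (W \<omega> j)\<^sup>2 / (2 * R)))"
    have "\<bar>(\<integral>\<omega>. \<psi> (max_abs K (W \<omega>)) \<partial>Q) - (\<integral>\<omega>. \<psi> (?S \<omega>) \<partial>Q)\<bar>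
        = \<bar>\<integral>\<omega>. \<psi> (max_abs K (W \<omega>)) - \<psi> (?S \<omega>) \<partial>Q\<bar>"
      by (subst Bochner_Integration.integral_diff) (auto intro!: int)
    also have "\<dots> \<le> (\<integral>\<omega>. \<bar>\<psi> (max_abs K (W \<omega>)) - \<psi> (?S \<omega>)\<bar> \<partial>Q)"
      by (rule integral_abs_bound)
    also have "\<dots> \<le> (\<integral>\<omega>. ?D \<omega> \<partial>Q)"
    proof (rule integral_mono)
      show "integrable Q (\<lambda>\<omega>. \<bar>\<psi> (max_abs K (W \<omega>)) - \<psi> (?S \<omega>)\<bar>)"
        by (intro integrable_abs Bochner_Integration.integrable_diff int) auto
      show "integrable Q ?D"
        by (intro integrable_mult_right Bochner_Integration.integrable_add Bochner_Integration.integrable_sum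
            integrable_divide_zero multinomial_process_second_moment) auto
      fix \<omega>
      have "\<bar>max_abs J (W \<omega>) - ?S \<omega>\<bar> \<le> (\<Sum>j<J. \<bar>W \<omega> j - R * sin (W \<omega> j / R)\<bar>)"
        by (rule max_abs_diff_le)
      also have "\<dots> \<le> (\<Sum>j<J. (W \<omega> j)\<^sup>2 / (2 * R))"
        using abs_scaled_sin_diff_le[OF \<open>R > 0\<close>] by (intro sum_mono) (simp add: abs_minus_commute)
      finally have "\<bar>max_abs K (W \<omega>) - ?S \<omega>\<bar> \<le> e + (\<Sum>j=J..<K. (W \<omega> j)\<^sup>2 / e) + (\<Sum>j<J. (W \<omega> j)\<^sup>2 / (2 * R))"
        using max_abs_tail[OF \<open>e > 0\<close> that, of "W \<omega>"] by linarith
      then show "\<bar>\<psi> (max_abs K (W \<omega>)) - \<psi> (?S \<omega>)\<bar> \<le> ?D \<omega>"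
        using lip order_trans mult_left_mono[OF _ \<open>L \<ge> 0\<close>] by blast
    qed
    also have "\<dots> = L * (e + (\<Sum>j=J..<K. (\<integral>\<omega>. (W \<omega> j)\<^sup>2 \<partial>Q) / e) + (\<Sum>j<J. (\<integral>\<omega>. (W \<omega> j)\<^sup>2 \<partial>Q) / (2 * R)))"
      by (simp add: multinomial_process_second_moment Bochner_Integration.integral_add Bochner_Integration.integral_sum
          Bochner_Integration.integrable_add prob_space del: sum_divide_distrib)
    also have "\<dots> \<le> L * (e + (\<Sum>j=J..<K. 2 * f j / e) + (\<Sum>j<J. 2 * f j / (2 * R)))"
      using \<open>e > 0\<close> \<open>R > 0\<close> \<open>L \<ge> 0\<close>
      by (intro mult_left_mono add_mono sum_mono divide_right_mono multinomial_process_second_moment) auto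
    \<comment> \<open>The mass of \<open>f\<close> between \<open>J\<close> and \<open>K\<close> is
      at most what is missing from 1 below \<open>J\<close>, and the mass below \<open>J\<close> is
      at most 1.\<close>
    also have "\<dots> \<le> L * (e + 2 * (1 - (\<Sum>j<J. f j)) / e + 1 / R)"
    proof -
      have "(\<Sum>j=J..<K. 2 * f j / e) = 2 * (\<Sum>j=J..<K. f j) / e"
        by (simp add: sum_distrib_left sum_divide_distrib)
      moreover have "(\<Sum>j=J..<K. f j) = (\<Sum>j<K. f j) - (\<Sum>j<J. f j)"
        using sum_diff_nat_ivl[of 0 J K f] that by (simp add: atLeast0LessThan)
      ultimately have "(\<Sum>j=J..<K. 2 * f j / e) \<le> 2 * (1 - (\<Sum>j<J. f j)) / e"
        using part[of K] \<open>e > 0\<close> by (simp add: divide_right_mono)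
      moreover have "(\<Sum>j<J. 2 * f j / (2 * R)) \<le> 1 / R"
        using part[of J] \<open>R > 0\<close> by (simp add: divide_right_mono flip: sum_divide_distrib)
      ultimately show ?thesis using \<open>L \<ge> 0\<close> by (intro mult_left_mono) auto
    qed
    finally show ?thesis .
  qed
  have "(\<lambda>K. \<integral>\<omega>. \<psi> (max_abs K (W \<omega>)) \<partial>Q) \<longlonglongrightarrow> (\<integral>\<omega>. \<psi> (lp_norm \<infinity> (W \<omega>)) \<partial>Q)"
    by (rule integral_dominated_convergence[where w = "\<lambda>_. B"])
       (auto simp: bdd intro!: continuous_on_tendsto_compose[OF cont] max_abs_tendsto multinomial_process_bdd)
  then have "(\<lambda>K. \<bar>(\<integral>\<omega>. \<psi> (max_abs K (W \<omega>)) \<partial>Q) - (\<integral>\<omega>. \<psi> (?S \<omega>) \<partial>Q)\<bar>) \<longlonglongrightarrow>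
      \<bar>(\<integral>\<omega>. \<psi> (lp_norm \<infinity> (W \<omega>)) \<partial>Q) - (\<integral>\<omega>. \<psi> (?S \<omega>) \<partial>Q)\<bar>"
    by (intro tendsto_intros)
  then show ?thesis
    by (rule LIMSEQ_le_const2) (use bound in blast)
qed

end

lemma expectation_trig_tendsto:
  fixes W :: "nat \<Rightarrow> 'c \<Rightarrow> nat \<Rightarrow> real" and V :: "'b \<Rightarrow> nat \<Rightarrow> real"
  assumes W: "\<And>n. multinomial_process (f n) (Q n) (W n)" and V: "multinomial_process g P V"
    and f: "\<And>j. (\<lambda>n. f n j) \<longlonglongrightarrow> g j" and t: "t \<in> trig J"
  shows "(\<lambda>n. \<integral>\<omega>. t (W n \<omega>) \<partial>Q n) \<longlonglongrightarrow> (\<integral>\<omega>. t (V \<omega>) \<partial>P)"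
  using t
proof induction
  case (wave c h)
  show ?case unfolding multinomial_process_cos[OF W] multinomial_process_cos[OF V]
    by (intro tendsto_intros multinomial_variance_tendsto f) auto
next
  case (add s t)
  then show ?case
    by (simp add: integrable_trig[OF W] integrable_trig[OF V] tendsto_add)
next
  case (scale s a)
  then show ?case by (simp add: tendsto_mult_left)
qed

text \<open>The truncation error has to be small for all large \<open>n\<close> at once. Each
  \<open>f n\<close> has total mass 1, so convergence of the finitely many coordinates below
  \<open>J\<close> already makes the mass beyond \<open>J\<close> small.\<close>

theorem expectation_sup_norm_tendsto:
  fixes W :: "nat \<Rightarrow> 'c \<Rightarrow> nat \<Rightarrow> real" and V :: "'b \<Rightarrow> nat \<Rightarrow> real" and \<psi> :: "real \<Rightarrow> real"
  assumes W: "\<And>n. multinomial_process (f n) (Q n) (W n)" and V: "multinomial_process g P V"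
    and f: "\<And>n. f n \<in> prob_vectors" and g: "g \<in> prob_vectors"
    and lim: "\<And>j. (\<lambda>n. f n j) \<longlonglongrightarrow> g j"
    and lip: "\<And>x y. \<bar>\<psi> x - \<psi> y\<bar> \<le> L * \<bar>x - y\<bar>" and "L \<ge> 0" and bdd: "\<And>x. \<bar>\<psi> x\<bar> \<le> B"
  shows "(\<lambda>n. \<integral>\<omega>. \<psi> (lp_norm \<infinity> (W n \<omega>)) \<partial>Q n) \<longlonglongrightarrow> (\<integral>\<omega>. \<psi> (lp_norm \<infinity> (V \<omega>)) \<partial>P)"
proof (rule LIMSEQ_I)
  fix r :: real assume "r > 0"
  \<comment> \<open>With tail mass below \<open>e\<^sup>2\<close> and \<open>R = 1 / e\<close>, the
    truncation bound is at most \<open>L * (4 * e) \<le> r / 3\<close>. Adding \<open>r / 12\<close>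
    for the trigonometric polynomial costs \<open>5 * r / 12\<close> on either side; the middle
    comparison costs \<open>r / 12\<close>, in total \<open>11 * r / 12 < r\<close>. Dividing by
    \<open>L + 1\<close> covers \<open>L = 0\<close>.\<close>
  define e where "e = r / (12 * (L + 1))"
  have e: "e > 0" using \<open>r > 0\<close> \<open>L \<ge> 0\<close> by (simp add: e_def)
  have "(\<lambda>J. \<Sum>j<J. g j) \<longlonglongrightarrow> 1" using g by (simp add: prob_vectors_def sums_def)
  then have "\<forall>\<^sub>F J in sequentially. (\<Sum>j<J. g j) > 1 - e\<^sup>2"
    using e by (intro order_tendstoD(1)) auto
  then obtain J where J: "(\<Sum>j<J. g j) > 1 - e\<^sup>2" by (auto dest: eventually_happens)
  have "(\<lambda>n. \<Sum>j<J. f n j) \<longlonglongrightarrow> (\<Sum>j<J. g j)" by (intro tendsto_intros lim)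
  then have ev1: "\<forall>\<^sub>F n in sequentially. (\<Sum>j<J. f n j) > 1 - e\<^sup>2"
    using J by (rule order_tendstoD(1))
  define G where "G y = \<psi> (max_abs J (\<lambda>j. (1 / e) * sin (y j / (1 / e))))" for y
  have "L-lipschitz_on UNIV \<psi>"
    using lip \<open>L \<ge> 0\<close> by (auto simp: lipschitz_on_def dist_real_def)
  then have cont: "continuous_on UNIV \<psi>" by (rule lipschitz_on_continuous_on)
  have "G \<in> trig_closure J"
    unfolding G_def by (rule trig_closure_continuous[OF cont max_abs_sin_trig_closure]) simp
  then obtain t where t: "t \<in> trig J" "\<And>y. \<bar>G y - t y\<bar> \<le> r / 12"
    using \<open>r > 0\<close> unfolding trig_closure_def by (force dest: spec[of _ "r / 12"])
  \<comment> \<open>Stated for an arbitrary space, since it is applied both to the approximating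
    processes and to the limit, whose sample spaces have different types.\<close>
  have near: "\<bar>(\<integral>\<omega>. \<psi> (lp_norm \<infinity> (U \<omega>)) \<partial>R) - (\<integral>\<omega>. t (U \<omega>) \<partial>R)\<bar> \<le> 5 * r / 12"
    if U: "multinomial_process h R U" and h: "h \<in> prob_vectors" and tail: "(\<Sum>j<J. h j) > 1 - e\<^sup>2"
    for h R and U :: "'d \<Rightarrow> nat \<Rightarrow> real"
  proof -
    interpret R: prob_space R using U by (rule multinomial_process_prob_space)
    have "2 * (1 - (\<Sum>j<J. h j)) / e \<le> 2 * e\<^sup>2 / e"
      using tail e by (intro divide_right_mono) auto
    then have *: "2 * (1 - (\<Sum>j<J. h j)) / e \<le> 2 * e" using e by (simp add: power2_eq_square)
    have "\<bar>(\<integral>\<omega>. \<psi> (lp_norm \<infinity> (U \<omega>)) \<partial>R) - (\<integral>\<omega>. G (U \<omega>) \<partial>R)\<bar>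
        \<le> L * (e + 2 * (1 - (\<Sum>j<J. h j)) / e + 1 / (1 / e))"
      unfolding G_def by (rule truncation_bound[OF U lip bdd h]) (use e \<open>L \<ge> 0\<close> in auto)
    also have "\<dots> \<le> L * (4 * e)"
      using * \<open>L \<ge> 0\<close> by (intro mult_left_mono) auto
    also have "\<dots> \<le> (L + 1) * (4 * e)" using e by (simp add: algebra_simps)
    also have "\<dots> = 4 * r / 12" using \<open>L \<ge> 0\<close> by (simp add: e_def field_simps)
    finally have 1: "\<bar>(\<integral>\<omega>. \<psi> (lp_norm \<infinity> (U \<omega>)) \<partial>R) - (\<integral>\<omega>. G (U \<omega>) \<partial>R)\<bar> \<le> 4 * r / 12" .
    have [measurable]: "\<psi> \<in> borel_measurable borel" using cont by (rule borel_measurable_continuous_onI)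
    have "integrable R (\<lambda>\<omega>. G (U \<omega>))"
      unfolding G_def
      by (intro R.integrable_const_bound[where B = B]
          measurable_compose[OF borel_measurable_max_abs_sin[OF U]]) (simp_all add: bdd)
    then have "(\<integral>\<omega>. G (U \<omega>) \<partial>R) - (\<integral>\<omega>. t (U \<omega>) \<partial>R) = (\<integral>\<omega>. G (U \<omega>) - t (U \<omega>) \<partial>R)"
      using integrable_trig[OF U t(1)] by simp
    moreover have "\<bar>\<integral>\<omega>. G (U \<omega>) - t (U \<omega>) \<partial>R\<bar> \<le> r / 12"
    proof -
      have "\<bar>\<integral>\<omega>. G (U \<omega>) - t (U \<omega>) \<partial>R\<bar> \<le> (\<integral>\<omega>. r / 12 \<partial>R)"
        using \<open>integrable R (\<lambda>\<omega>. G (U \<omega>))\<close> integrable_trig[OF U t(1)] t(2)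
        by (intro order_trans[OF integral_abs_bound] integral_mono) auto
      then show ?thesis by (simp add: R.prob_space)
    qed
    ultimately show ?thesis using 1 by linarith
  qed
  have "\<forall>\<^sub>F n in sequentially. dist (\<integral>\<omega>. t (W n \<omega>) \<partial>Q n) (\<integral>\<omega>. t (V \<omega>) \<partial>P) < r / 12"
    by (rule tendstoD[OF expectation_trig_tendsto[OF W V lim t(1)]]) (use \<open>r > 0\<close> in simp)
  with ev1 have "\<forall>\<^sub>F n in sequentially.
      norm ((\<integral>\<omega>. \<psi> (lp_norm \<infinity> (W n \<omega>)) \<partial>Q n) - (\<integral>\<omega>. \<psi> (lp_norm \<infinity> (V \<omega>)) \<partial>P)) < r"
  proof eventually_elim
    case (elim n)
    with near[OF W f elim(1)] near[OF V g J] \<open>r > 0\<close> show ?case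
      unfolding dist_real_def real_norm_def by argo
  qed
  then show "\<exists>N. \<forall>n\<ge>N. norm ((\<integral>\<omega>. \<psi> (lp_norm \<infinity> (W n \<omega>)) \<partial>Q n) - (\<integral>\<omega>. \<psi> (lp_norm \<infinity> (V \<omega>)) \<partial>P)) < r"
    by (simp add: eventually_sequentially)
qed

section \<open>Gaussian elements and rotations\<close>

text \<open>The characteristic function of a centered normal variable is real, so the sine part
  vanishes and the phase only contributes \<open>cos c\<close>. The point mass at 0 obeys the same
  formula with variance 0.\<close>

lemma (in prob_space) integral_cos_centered_gaussian:
  assumes X: "centered_gaussian_real M X"
  shows "integrable M (\<lambda>\<omega>. (X \<omega>)\<^sup>2)"
    and "(\<integral>\<omega>. cos (c + X \<omega>) \<partial>M) = cos c * exp (- (\<integral>\<omega>. (X \<omega>)\<^sup>2 \<partial>M) / 2)"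
proof -
  have [measurable]: "X \<in> borel_measurable M" using X by (simp add: centered_gaussian_real_def)
  consider "AE \<omega> in M. X \<omega> = 0" | \<sigma> where "\<sigma> > 0" "distributed M lborel X (normal_density 0 \<sigma>)"
    using X by (auto simp: centered_gaussian_real_def)
  then have "integrable M (\<lambda>\<omega>. (X \<omega>)\<^sup>2) \<and>
    (\<integral>\<omega>. cos (c + X \<omega>) \<partial>M) = cos c * exp (- (\<integral>\<omega>. (X \<omega>)\<^sup>2 \<partial>M) / 2)"
  proof cases
    case 1
    have "integrable M (\<lambda>\<omega>. (X \<omega>)\<^sup>2)"
      by (rule integrable_cong_AE_imp[where g = "\<lambda>_. 0"]) (use 1 in auto)
    moreover have "(\<integral>\<omega>. (X \<omega>)\<^sup>2 \<partial>M) = (\<integral>\<omega>. 0 \<partial>M)"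
      by (rule integral_cong_AE) (use 1 in auto)
    moreover have "(\<integral>\<omega>. cos (c + X \<omega>) \<partial>M) = (\<integral>\<omega>. cos c \<partial>M)"
      by (rule integral_cong_AE) (use 1 in auto)
    ultimately show ?thesis by (simp add: prob_space)
  next
    case (2 \<sigma>)
    have int2: "integrable M (\<lambda>\<omega>. (X \<omega>)\<^sup>2)"
      using distributed_integrable[OF 2(2), of "\<lambda>x. x\<^sup>2"] integrable_normal_moment[OF 2(1), of 0 2] by simp
    have var: "(\<integral>\<omega>. (X \<omega>)\<^sup>2 \<partial>M) = \<sigma>\<^sup>2"
      using normal_distributed_variance[OF 2] normal_distributed_expectation[OF 2] by simp
    \<comment> \<open>The characteristic function of \<open>X\<close> at 1 is that of the standard
      normal variable \<open>X / \<sigma>\<close> at \<open>\<sigma>\<close>.\<close>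
    have "distributed M lborel (\<lambda>\<omega>. X \<omega> / \<sigma>) std_normal_density"
      using 2 normal_standard_normal_convert[OF 2(1), of X 0] by simp
    then have "distr M lborel (\<lambda>\<omega>. X \<omega> / \<sigma>) = std_normal_distribution"
      by (simp add: distributed_distr_eq_density)
    then have "char (distr M lborel (\<lambda>\<omega>. X \<omega> / \<sigma>)) \<sigma> = complex_of_real (exp (- (\<sigma>\<^sup>2) / 2))"
      by (simp add: char_std_normal_distribution)
    moreover have "char (distr M lborel (\<lambda>\<omega>. X \<omega> / \<sigma>)) \<sigma> = (CLINT \<omega>|M. iexp (X \<omega>))"
      unfolding char_def using 2(1) by (subst integral_distr) auto
    ultimately have ch: "(CLINT \<omega>|M. iexp (X \<omega>)) = complex_of_real (exp (- (\<sigma>\<^sup>2) / 2))" by simp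
    have int: "integrable M (\<lambda>\<omega>. iexp (X \<omega>))" 
      by (rule integrable_const_bound[where B = 1]) auto
    have "(\<integral>\<omega>. cos (X \<omega>) \<partial>M) = Re (CLINT \<omega>|M. iexp (X \<omega>))"
      by (subst integral_Re[OF int, symmetric]) (simp add: Re_exp)
    moreover have "(\<integral>\<omega>. sin (X \<omega>) \<partial>M) = Im (CLINT \<omega>|M. iexp (X \<omega>))"
      by (subst integral_Im[OF int, symmetric]) (simp add: Im_exp)
    moreover have "(\<integral>\<omega>. cos (c + X \<omega>) \<partial>M) = cos c * (\<integral>\<omega>. cos (X \<omega>) \<partial>M) - sin c * (\<integral>\<omega>. sin (X \<omega>) \<partial>M)"
      unfolding cos_add
      by (subst Bochner_Integration.integral_diff)
         (auto intro!: integrable_const_bound[where B = 1])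
    ultimately show ?thesis using int2 by (simp add: ch var)
  qed
  then show "integrable M (\<lambda>\<omega>. (X \<omega>)\<^sup>2)"
    "(\<integral>\<omega>. cos (c + X \<omega>) \<partial>M) = cos c * exp (- (\<integral>\<omega>. (X \<omega>)\<^sup>2 \<partial>M) / 2)" by auto
qed

lemma finite_support_ell2: "(\<lambda>j. if j < J then h j else 0) \<in> ell2"
  unfolding ell2_def by (auto intro!: summable_finite[of "{..<J}"] split: if_splits)

lemma unit_seq_ell2: "unit_seq i \<in> ell2"
  unfolding ell2_def unit_seq_def by (auto intro!: summable_finite[of "{i}"])

lemma ell2_inner_finite_support:
  "ell2_inner y (\<lambda>j. if j < J then h j else 0) = (\<Sum>j<J. h j * y j)"
proof -
  have "(\<Sum>j. y j * (if j < J then h j else 0)) = (\<Sum>j<J. y j * (if j < J then h j else 0))"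
    by (rule suminf_finite) auto
  then show ?thesis by (simp add: ell2_inner_def mult.commute)
qed

lemma ell2_inner_unit_seq: "ell2_inner y (unit_seq i) = y i"
proof -
  have "(\<Sum>j. y j * unit_seq i j) = (\<Sum>j\<in>{i}. y j * unit_seq i j)"
    by (rule suminf_finite) (auto simp: unit_seq_def)
  then show ?thesis by (simp add: ell2_inner_def unit_seq_def)
qed

lemma ell2_bdd_above:
  assumes "y \<in> ell2" shows "bdd_above (range (\<lambda>j. \<bar>y j\<bar>))"
proof -
  have s: "summable (\<lambda>j. (y j)\<^sup>2)" using assms by (simp add: ell2_def)
  have "\<bar>y j\<bar> \<le> 1 + (\<Sum>j. (y j)\<^sup>2)" for j
    using le_add_square_div[of 1 "y j"] sum_le_suminf[OF s, of "{j}"] by simp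
  then show ?thesis by (auto simp: bdd_above_def)
qed

text \<open>The covariance operator, evaluated at unit vectors, gives the value of the integral but
  says nothing about integrability, as a non-integrable function has integral 0. Integrability comes
  from the Gaussian coordinates.\<close>

lemma multinomial_gaussian_moments:
  assumes mg: "multinomial_gaussian f N Y"
  shows "integrable N (\<lambda>\<omega>. Y \<omega> i * Y \<omega> k)"
    and "(\<integral>\<omega>. Y \<omega> i * Y \<omega> k \<partial>N) = f i * of_bool (i = k) - f i * f k"
proof -
  interpret prob_space N using mg by (simp add: multinomial_gaussian_def)
  have g: "centered_gaussian_real N (\<lambda>\<omega>. Y \<omega> j)" for j
    using mg unit_seq_ell2[of j]
    by (auto simp: multinomial_gaussian_def centered_gaussian_ell2_def ell2_inner_unit_seq dest: bspec[of _ _ "unit_seq j"])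
  then have [measurable]: "(\<lambda>\<omega>. Y \<omega> j) \<in> borel_measurable N" for j by (simp add: centered_gaussian_real_def)
  have sq: "integrable N (\<lambda>\<omega>. (Y \<omega> j)\<^sup>2)" for j by (rule integral_cos_centered_gaussian(1)[OF g])
  show "integrable N (\<lambda>\<omega>. Y \<omega> i * Y \<omega> k)"
  proof (rule Bochner_Integration.integrable_bound)
    show "integrable N (\<lambda>\<omega>. (Y \<omega> i)\<^sup>2 + (Y \<omega> k)\<^sup>2)" using sq by simp
    have "\<bar>a * b\<bar> \<le> a\<^sup>2 + b\<^sup>2" for a b :: real
    proof -
      have "2 * \<bar>a\<bar> * \<bar>b\<bar> \<le> \<bar>a\<bar>\<^sup>2 + \<bar>b\<bar>\<^sup>2" by (rule sum_squares_bound)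
      moreover have "0 \<le> \<bar>a\<bar> * \<bar>b\<bar>" by simp
      ultimately show ?thesis unfolding abs_mult power2_abs by linarith
    qed
    then show "AE \<omega> in N. norm (Y \<omega> i * Y \<omega> k) \<le> norm ((Y \<omega> i)\<^sup>2 + (Y \<omega> k)\<^sup>2)" by simp
  qed simp
  obtain C where C: "covariance_operator N Y C"
    "\<And>i i'. ell2_inner (C (unit_seq i)) (unit_seq i') = f i * of_bool (i = i') - f i * f i'"
    using mg by (auto simp: multinomial_gaussian_def)
  have "ell2_inner (C (unit_seq i)) (unit_seq k) =
     (LINT \<omega>|N. ell2_inner (Y \<omega>) (unit_seq i) * ell2_inner (Y \<omega>) (unit_seq k))"
    using C(1) unit_seq_ell2 unfolding covariance_operator_def by blast
  then have "ell2_inner (C (unit_seq i)) (unit_seq k) = (\<integral>\<omega>. Y \<omega> i * Y \<omega> k \<partial>N)"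
    by (simp only: ell2_inner_unit_seq)
  then show "(\<integral>\<omega>. Y \<omega> i * Y \<omega> k \<partial>N) = f i * of_bool (i = k) - f i * f k"
    unfolding C(2) by (rule sym)
qed

text \<open>A finite linear combination of coordinates is an inner product with a finitely supported
  vector, hence a centered real Gaussian, and its cosine expectation is determined by its
  variance.\<close>

lemma multinomial_gaussian_process:
  assumes mg: "multinomial_gaussian f N Y" and f: "f \<in> prob_vectors"
  shows "multinomial_process f N Y"
  unfolding multinomial_process_def
proof (intro conjI allI ballI)
  interpret prob_space N using mg by (simp add: multinomial_gaussian_def)
  show "prob_space N" by (rule prob_space_axioms)
  have Y: "Y \<in> measurable N ell2_borel" "\<And>h. h \<in> ell2 \<Longrightarrow> centered_gaussian_real N (\<lambda>\<omega>. ell2_inner (Y \<omega>) h)"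
    using mg by (auto simp: multinomial_gaussian_def centered_gaussian_ell2_def)
  show "(\<lambda>\<omega>. Y \<omega> j) \<in> borel_measurable N" for j
    using Y(2)[OF unit_seq_ell2[of j]] by (simp add: ell2_inner_unit_seq centered_gaussian_real_def)
  have "space ell2_borel = ell2"
    unfolding ell2_borel_def by (rule space_measure_of) auto
  then show "bdd_above (range (\<lambda>j. \<bar>Y \<omega> j\<bar>))" if "\<omega> \<in> space N" for \<omega>
    using measurable_space[OF Y(1) that] by (simp add: ell2_bdd_above)
  show "integrable N (\<lambda>\<omega>. (Y \<omega> j)\<^sup>2)" for j
    using multinomial_gaussian_moments(1)[OF mg, of j j] by (simp add: power2_eq_square)
  show "(\<integral>\<omega>. (Y \<omega> j)\<^sup>2 \<partial>N) \<le> 2 * f j" for j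
  proof -
    have "0 \<le> f j" using f by (simp add: prob_vectors_def)
    then have "f j - f j * f j \<le> 2 * f j" using zero_le_square[of "f j"] by linarith
    then show ?thesis
      using multinomial_gaussian_moments(2)[OF mg, of j j] by (simp add: power2_eq_square)
  qed
  show "(\<integral>\<omega>. cos (c + (\<Sum>j<J. h j * Y \<omega> j)) \<partial>N) = cos c * exp (- multinomial_variance f J h / 2)" for J c h
  proof -
    have "centered_gaussian_real N (\<lambda>\<omega>. \<Sum>j<J. h j * Y \<omega> j)"
      using Y(2)[OF finite_support_ell2[of J h]] by (simp add: ell2_inner_finite_support)
    from integral_cos_centered_gaussian(2)[OF this, of c]
    have "(\<integral>\<omega>. cos (c + (\<Sum>j<J. h j * Y \<omega> j)) \<partial>N) =
      cos c * exp (- (\<integral>\<omega>. (\<Sum>j<J. h j * Y \<omega> j)\<^sup>2 \<partial>N) / 2)" .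
    also have "(\<integral>\<omega>. (\<Sum>j<J. h j * Y \<omega> j)\<^sup>2 \<partial>N) = (\<integral>\<omega>. (\<Sum>i<J. \<Sum>k<J. h i * h k * (Y \<omega> i * Y \<omega> k)) \<partial>N)"
      by (simp add: power2_eq_square sum_product mult_ac)
    also have "\<dots> = multinomial_variance f J h"
      unfolding multinomial_variance_def
      by (subst Bochner_Integration.integral_sum, intro Bochner_Integration.integrable_sum integrable_mult_right
          multinomial_gaussian_moments(1)[OF mg], rule sum.cong, rule refl,
          subst Bochner_Integration.integral_sum, intro integrable_mult_right
          multinomial_gaussian_moments(1)[OF mg])
         (simp add: multinomial_gaussian_moments(2)[OF mg])
    finally show ?thesis .
  qed
qed

text \<open>Independence splits the cosine expectation into two exponentials whose exponents carry
  the weights \<open>a\<^sup>2\<close> and \<open>b\<^sup>2\<close>, which sum to 1. The bound in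
  \<open>var\<close> lacks the factor 2 because the estimate of the rotated second moment uses that
  factor up.\<close>

lemma rotation_process:
  assumes mp: "multinomial_process f N Y" and var: "\<And>j. (\<integral>\<omega>. (Y \<omega> j)\<^sup>2 \<partial>N) \<le> f j"
    and ab: "a\<^sup>2 + b\<^sup>2 = 1"
  shows "multinomial_process f (N \<Otimes>\<^sub>M N) (\<lambda>\<omega> j. a * Y (fst \<omega>) j + b * Y (snd \<omega>) j)"
  unfolding multinomial_process_def
proof (intro conjI allI ballI)
  interpret N: prob_space N using mp by (rule multinomial_process_prob_space)
  interpret P: pair_prob_space N N ..
  note multinomial_process_measurable[OF mp, measurable]
  let ?Q = "N \<Otimes>\<^sub>M N" and ?W = "\<lambda>\<omega> j. a * Y (fst \<omega>) j + b * Y (snd \<omega>) j"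
  show "prob_space ?Q" by (rule P.prob_space_axioms)
  show meas [measurable]: "(\<lambda>\<omega>. ?W \<omega> j) \<in> borel_measurable ?Q" for j by measurable
  show "bdd_above (range (\<lambda>j. \<bar>?W \<omega> j\<bar>))" if "\<omega> \<in> space ?Q" for \<omega>
  proof -
    have "fst \<omega> \<in> space N" "snd \<omega> \<in> space N" using that by (auto simp: space_pair_measure)
    then obtain B C where "\<And>j. \<bar>Y (fst \<omega>) j\<bar> \<le> B" "\<And>j. \<bar>Y (snd \<omega>) j\<bar> \<le> C"
      using multinomial_process_bdd[OF mp, of "fst \<omega>"] multinomial_process_bdd[OF mp, of "snd \<omega>"] unfolding bdd_above_def by auto
    then have "\<bar>?W \<omega> j\<bar> \<le> \<bar>a\<bar> * B + \<bar>b\<bar> * C" for j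
      by (intro order_trans[OF abs_triangle_ineq] add_mono) (auto simp: abs_mult mult_left_mono)
    then show ?thesis unfolding bdd_above_def by blast
  qed
  have fst: "integrable ?Q (\<lambda>\<omega>. (Y (fst \<omega>) j)\<^sup>2)" "(\<integral>\<omega>. (Y (fst \<omega>) j)\<^sup>2 \<partial>?Q) = (\<integral>\<omega>. (Y \<omega> j)\<^sup>2 \<partial>N)" for j
    using integrable_distr_eq[of fst ?Q N "\<lambda>\<omega>. (Y \<omega> j)\<^sup>2"] integral_distr[of fst ?Q N "\<lambda>\<omega>. (Y \<omega> j)\<^sup>2"]
      multinomial_process_second_moment[OF mp] by (simp_all add: N.distr_pair_fst)
  have "distr ?Q N snd = distr (distr ?Q ?Q (\<lambda>(x, y). (y, x))) N fst"
    by (subst distr_distr) (auto simp: comp_def case_prod_beta)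
  also have "\<dots> = N" by (simp add: P.distr_pair_swap[symmetric] N.distr_pair_fst)
  finally have dsnd: "distr ?Q N snd = N" .
  have snd: "integrable ?Q (\<lambda>\<omega>. (Y (snd \<omega>) j)\<^sup>2)" "(\<integral>\<omega>. (Y (snd \<omega>) j)\<^sup>2 \<partial>?Q) = (\<integral>\<omega>. (Y \<omega> j)\<^sup>2 \<partial>N)" for j
    using integrable_distr_eq[of snd ?Q N "\<lambda>\<omega>. (Y \<omega> j)\<^sup>2"] integral_distr[of snd ?Q N "\<lambda>\<omega>. (Y \<omega> j)\<^sup>2"]
      multinomial_process_second_moment[OF mp] by (simp_all add: dsnd)
  \<comment> \<open>Cauchy--Schwarz by Lagrange's identity. It avoids the cross moments of the two
    copies.\<close>
  have cs: "(a * x + b * y)\<^sup>2 \<le> x\<^sup>2 + y\<^sup>2" for x y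
  proof -
    have "(a\<^sup>2 + b\<^sup>2) * (x\<^sup>2 + y\<^sup>2) - (a * x + b * y)\<^sup>2 = (a * y - b * x)\<^sup>2"
      by (simp add: power2_eq_square algebra_simps)
    then have "x\<^sup>2 + y\<^sup>2 - (a * x + b * y)\<^sup>2 = (a * y - b * x)\<^sup>2" using ab by simp
    then show ?thesis using zero_le_power2[of "a * y - b * x"] by linarith
  qed
  show i: "integrable ?Q (\<lambda>\<omega>. (?W \<omega> j)\<^sup>2)" for j
    by (rule Bochner_Integration.integrable_bound[OF Bochner_Integration.integrable_add[OF fst(1) snd(1)]])
       (use cs in auto)
  have le: "(\<integral>\<omega>. (?W \<omega> j)\<^sup>2 \<partial>?Q) \<le> (\<integral>\<omega>. (Y (fst \<omega>) j)\<^sup>2 + (Y (snd \<omega>) j)\<^sup>2 \<partial>?Q)" for j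
    by (intro integral_mono i Bochner_Integration.integrable_add fst snd cs)
  show "(\<integral>\<omega>. (?W \<omega> j)\<^sup>2 \<partial>?Q) \<le> 2 * f j" for j
    using le[of j] var[of j] by (simp add: fst snd)
  show "(\<integral>\<omega>. cos (c + (\<Sum>j<J. h j * ?W \<omega> j)) \<partial>?Q) = cos c * exp (- multinomial_variance f J h / 2)" for J c h
  proof -
    have scale: "multinomial_variance f J (\<lambda>j. r * h j) = r\<^sup>2 * multinomial_variance f J h" for r
      by (simp add: multinomial_variance_def sum_distrib_left power2_eq_square mult_ac)
    \<comment> \<open>For fixed \<open>x\<close> the first copy is absorbed into the phase. The
      inner integral leaves a multiple of a wave in \<open>x\<close>, to which the same formula
      applies again.\<close>
    have split: "c + (\<Sum>j<J. h j * ?W (x, y) j) = (c + (\<Sum>j<J. (a * h j) * Y x j)) + (\<Sum>j<J. (b * h j) * Y y j)" for x y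
      by (simp add: sum.distrib algebra_simps)
    have "integrable ?Q (\<lambda>\<omega>. cos (c + (\<Sum>j<J. h j * ?W \<omega> j)))"
      by (rule P.integrable_const_bound[where B = 1]) auto
    from P.integral_fst'[OF this]
    have "(\<integral>\<omega>. cos (c + (\<Sum>j<J. h j * ?W \<omega> j)) \<partial>?Q) =
      (\<integral>x. (\<integral>y. cos ((c + (\<Sum>j<J. (a * h j) * Y x j)) + (\<Sum>j<J. (b * h j) * Y y j)) \<partial>N) \<partial>N)"
      unfolding split by simp
    also have "\<dots> = cos c * exp (- (a\<^sup>2 * multinomial_variance f J h) / 2) * exp (- (b\<^sup>2 * multinomial_variance f J h) / 2)"
      unfolding multinomial_process_cos[OF mp] scale by (simp add: multinomial_process_cos[OF mp] scale)
    also have "\<dots> = cos c * exp (- ((a\<^sup>2 + b\<^sup>2) * multinomial_variance f J h) / 2)"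
      by (simp add: add_divide_distrib diff_divide_distrib distrib_right flip: exp_add)
    finally show ?thesis by (simp add: ab)
  qed
qed

section \<open>Gaps in the law of the sup norm\<close>

lemma lp_norm_inf_diff_le:
  assumes "bdd_above (range (\<lambda>j. \<bar>u j\<bar>))" "bdd_above (range (\<lambda>j. \<bar>v j\<bar>))"
    and D: "\<And>j. \<bar>u j - v j\<bar> \<le> D"
  shows "\<bar>lp_norm \<infinity> u - lp_norm \<infinity> v\<bar> \<le> D"
proof -
  have "\<bar>u j\<bar> \<le> lp_norm \<infinity> v + D" "\<bar>v j\<bar> \<le> lp_norm \<infinity> u + D" for j
    using D[of j] abs_le_lp_norm_inf[OF assms(1), of j] abs_le_lp_norm_inf[OF assms(2), of j] by linarith+
  then have "lp_norm \<infinity> u \<le> lp_norm \<infinity> v + D" "lp_norm \<infinity> v \<le> lp_norm \<infinity> u + D"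
    by (auto intro: lp_norm_inf_le)
  then show ?thesis by linarith
qed

lemma continuous_on_lp_norm_inf_rotation:
  assumes "bdd_above (range (\<lambda>j. \<bar>u j\<bar>))" "bdd_above (range (\<lambda>j. \<bar>v j\<bar>))"
  shows "continuous_on UNIV (\<lambda>\<theta>. lp_norm \<infinity> (\<lambda>j. cos \<theta> * u j + sin \<theta> * v j))"
proof -
  obtain A B where A: "\<And>j. \<bar>u j\<bar> \<le> A" and B: "\<And>j. \<bar>v j\<bar> \<le> B"
    using assms unfolding bdd_above_def by fast
  let ?w = "\<lambda>\<theta> j. cos \<theta> * u j + sin \<theta> * v j"
  have "\<bar>?w \<theta> j\<bar> \<le> A + B" for \<theta> j
    by (intro order_trans[OF abs_triangle_ineq] add_mono order_trans[OF _ A[of j]] order_trans[OF _ B[of j]])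
       (auto simp: abs_mult intro!: mult_left_le_one_le)
  then have bdd: "bdd_above (range (\<lambda>j. \<bar>?w \<theta> j\<bar>))" for \<theta> unfolding bdd_above_def by blast
  have "((\<lambda>y. lp_norm \<infinity> (?w y) - lp_norm \<infinity> (?w x)) \<longlongrightarrow> 0) (at x)" for x
  proof (rule Lim_null_comparison)
    have "\<bar>lp_norm \<infinity> (?w y) - lp_norm \<infinity> (?w x)\<bar> \<le> \<bar>cos y - cos x\<bar> * A + \<bar>sin y - sin x\<bar> * B" for y
    proof (rule lp_norm_inf_diff_le[OF bdd bdd])
      fix j
      have "?w y j - ?w x j = (cos y - cos x) * u j + (sin y - sin x) * v j" by (simp add: algebra_simps)
      also have "\<bar>\<dots>\<bar> \<le> \<bar>cos y - cos x\<bar> * A + \<bar>sin y - sin x\<bar> * B"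
        by (intro order_trans[OF abs_triangle_ineq] add_mono) (auto simp: abs_mult intro!: mult_left_mono A B)
      finally show "\<bar>?w y j - ?w x j\<bar> \<le> \<bar>cos y - cos x\<bar> * A + \<bar>sin y - sin x\<bar> * B" .
    qed
    then show "\<forall>\<^sub>F y in at x. norm (lp_norm \<infinity> (?w y) - lp_norm \<infinity> (?w x)) \<le> \<bar>cos y - cos x\<bar> * A + \<bar>sin y - sin x\<bar> * B"
      by simp
    have "((\<lambda>y. \<bar>cos y - cos x\<bar> * A + \<bar>sin y - sin x\<bar> * B) \<longlongrightarrow> \<bar>cos x - cos x\<bar> * A + \<bar>sin x - sin x\<bar> * B) (at x)"
      by (intro tendsto_intros)
    then show "((\<lambda>y. \<bar>cos y - cos x\<bar> * A + \<bar>sin y - sin x\<bar> * B) \<longlongrightarrow> 0) (at x)" by simp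
  qed
  then show ?thesis
    by (auto simp: continuous_on_def LIM_zero_iff)
qed

text \<open>Along the rotation \<open>\<theta> \<mapsto> cos \<theta> Y + sin \<theta> Y'\<close> from \<open>Y\<close> to an independent copy
  \<open>Y'\<close> the law is constant, so almost surely the norm avoids a gap \<open>(a, b)\<close> at all rational
  angles and, by continuity, at all angles.  By the intermediate value theorem the events
  \<open>\<parallel>Y\<parallel> \<le> a\<close> and \<open>\<parallel>Y'\<parallel> \<le> a\<close> then agree, and being independent they are trivial.\<close>

lemma sup_norm_gap_zero_one:
  assumes mp: "multinomial_process f N Y" and var: "\<And>j. (\<integral>\<omega>. (Y \<omega> j)\<^sup>2 \<partial>N) \<le> f j"
    and f: "f \<in> prob_vectors" and "a < b"
    and gap: "AE \<omega> in N. \<not> (a < lp_norm \<infinity> (Y \<omega>) \<and> lp_norm \<infinity> (Y \<omega>) < b)"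
  shows "measure N {\<omega>\<in>space N. lp_norm \<infinity> (Y \<omega>) > a} \<in> {0, 1}"
proof -
  interpret N: prob_space N using mp by (rule multinomial_process_prob_space)
  interpret P: pair_prob_space N N ..
  note borel_measurable_lp_norm_inf[OF mp, measurable]
  let ?Q = "N \<Otimes>\<^sub>M N"
  define F where "F \<omega> \<theta> = lp_norm \<infinity> (\<lambda>j. cos \<theta> * Y (fst \<omega>) j + sin \<theta> * Y (snd \<omega>) j)" for \<omega> \<theta>
  \<comment> \<open>A tent that is positive exactly on \<open>(a, b)\<close>: the gap becomes the
    vanishing of the expectation of a bounded Lipschitz function.\<close>
  define \<psi> where "\<psi> x = max 0 ((b - a) / 2 - \<bar>x - (a + b) / 2\<bar>)" for x
  have pos: "0 < \<psi> x \<longleftrightarrow> a < x \<and> x < b" and nn: "0 \<le> \<psi> x" and le: "\<bar>\<psi> x\<bar> \<le> b - a" for x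
    using \<open>a < b\<close> by (auto simp: \<psi>_def max_def abs_if field_simps)
  have lip: "\<bar>\<psi> x - \<psi> y\<bar> \<le> 1 * \<bar>x - y\<bar>" for x y
  proof -
    have "\<bar>max 0 s - max 0 t\<bar> \<le> \<bar>s - t\<bar>" for s t :: real by (simp add: max_def)
    then have "\<bar>\<psi> x - \<psi> y\<bar> \<le> \<bar>\<bar>y - (a + b) / 2\<bar> - \<bar>x - (a + b) / 2\<bar>\<bar>"
      unfolding \<psi>_def by (rule order_trans) simp
    also have "\<dots> \<le> \<bar>x - y\<bar>"
      using abs_triangle_ineq3[of "y - (a + b) / 2" "x - (a + b) / 2"] by (simp add: abs_minus_commute)
    finally show ?thesis by simp
  qed
  have "continuous_on UNIV \<psi>" unfolding \<psi>_def by (intro continuous_intros)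
  then have [measurable]: "\<psi> \<in> borel_measurable borel" by (rule borel_measurable_continuous_onI)
  have rot: "multinomial_process f ?Q (\<lambda>\<omega> j. cos \<theta> * Y (fst \<omega>) j + sin \<theta> * Y (snd \<omega>) j)" for \<theta>
    by (rule rotation_process[OF mp var]) simp
  have F_meas [measurable]: "(\<lambda>\<omega>. F \<omega> \<theta>) \<in> borel_measurable ?Q" for \<theta>
    unfolding F_def by (rule borel_measurable_lp_norm_inf[OF rot])
  have "AE \<omega> in ?Q. \<not> (a < F \<omega> \<theta> \<and> F \<omega> \<theta> < b)" for \<theta>
  proof -
    \<comment> \<open>Weak continuity is applied to a sequence constant in \<open>n\<close>; its
      limit statement then says that the rotated pair and \<open>Y\<close> give the same
      expectation.\<close>
    have "(\<lambda>n::nat. \<integral>\<omega>. \<psi> (F \<omega> \<theta>) \<partial>?Q) \<longlonglongrightarrow> (\<integral>\<omega>. \<psi> (lp_norm \<infinity> (Y \<omega>)) \<partial>N)"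
      unfolding F_def by (rule expectation_sup_norm_tendsto[OF rot mp f f tendsto_const lip _ le]) simp
    then have "(\<integral>\<omega>. \<psi> (F \<omega> \<theta>) \<partial>?Q) = (\<integral>\<omega>. \<psi> (lp_norm \<infinity> (Y \<omega>)) \<partial>N)"
      by (simp add: LIMSEQ_const_iff)
    also have "\<dots> = (\<integral>\<omega>. 0 \<partial>N)"
    proof (rule integral_cong_AE)
      show "AE \<omega> in N. \<psi> (lp_norm \<infinity> (Y \<omega>)) = 0"
        using gap by eventually_elim (use pos nn in \<open>force simp: less_le\<close>)
    qed auto
    finally have "(\<integral>\<omega>. \<psi> (F \<omega> \<theta>) \<partial>?Q) = 0" by simp
    moreover have "integrable ?Q (\<lambda>\<omega>. \<psi> (F \<omega> \<theta>))"
      by (rule P.integrable_const_bound[where B = "b - a"]) (use le in auto)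
    ultimately have "AE \<omega> in ?Q. \<psi> (F \<omega> \<theta>) = 0"
      by (simp add: integral_nonneg_eq_0_iff_AE nn)
    then show ?thesis by eventually_elim (use pos in \<open>metis less_irrefl\<close>)
  qed
  then have avoid: "AE \<omega> in ?Q. \<forall>r::rat. \<not> (a < F \<omega> (of_rat r) \<and> F \<omega> (of_rat r) < b)"
    by (simp add: AE_all_countable)
  have IVT: "\<not> (lp_norm \<infinity> (Y (fst \<omega>)) \<le> a \<and> lp_norm \<infinity> (Y (snd \<omega>)) > a)"
    if \<omega>: "\<omega> \<in> space ?Q" and avoid: "\<forall>r::rat. \<not> (a < F \<omega> (of_rat r) \<and> F \<omega> (of_rat r) < b)" for \<omega>
  proof
    assume *: "lp_norm \<infinity> (Y (fst \<omega>)) \<le> a \<and> lp_norm \<infinity> (Y (snd \<omega>)) > a"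
    have cont: "continuous_on UNIV (F \<omega>)"
      unfolding F_def using \<omega>
      by (intro continuous_on_lp_norm_inf_rotation multinomial_process_bdd[OF mp]) (auto simp: space_pair_measure)
    have F: "F \<omega> 0 = lp_norm \<infinity> (Y (fst \<omega>))" "F \<omega> (pi / 2) = lp_norm \<infinity> (Y (snd \<omega>))"
      by (simp_all add: F_def)
    \<comment> \<open>A level inside the gap that the path must cross. The minimum covers both an
      end point in the gap and one beyond it.\<close>
    define m where "m = (a + min b (F \<omega> (pi / 2))) / 2"
    have m: "a < m" "m < b" "m < F \<omega> (pi / 2)" using * F \<open>a < b\<close> by (auto simp: m_def min_def)
    have "\<exists>x\<ge>0. x \<le> pi / 2 \<and> F \<omega> x = m"
      by (rule IVT') (use m * F continuous_on_subset[OF cont] in auto)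
    then obtain x where x: "F \<omega> x = m" by blast
    \<comment> \<open>The crossing angle may be irrational, but nearby angles still map into the
      gap, and a rational one is among them.\<close>
    have "open {y. a < F \<omega> y \<and> F \<omega> y < b}"
      by (intro open_Collect_conj open_Collect_less continuous_intros cont)
    then obtain d where d: "d > 0" "\<And>y. dist y x < d \<Longrightarrow> a < F \<omega> y \<and> F \<omega> y < b"
      using x m unfolding open_dist by blast
    obtain r :: rat where "x < of_rat r" "of_rat r < x + d"
      using of_rat_dense[of x "x + d"] d(1) by auto
    then have "dist (of_rat r) x < d" by (simp add: dist_real_def)
    from d(2)[OF this] avoid show False by blast
  qed
  have "AE \<omega> in ?Q. \<not> (lp_norm \<infinity> (Y (fst \<omega>)) \<le> a \<and> lp_norm \<infinity> (Y (snd \<omega>)) > a)"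
    by (rule AE_mp[OF avoid]) (intro AE_I2 impI IVT)
  moreover define A where "A = {\<omega>\<in>space N. lp_norm \<infinity> (Y \<omega>) > a}"
  have A [measurable]: "A \<in> sets N" unfolding A_def by measurable
  have "{\<omega>\<in>space ?Q. \<not> \<not> (lp_norm \<infinity> (Y (fst \<omega>)) \<le> a \<and> lp_norm \<infinity> (Y (snd \<omega>)) > a)} = (space N - A) \<times> A"
    by (auto simp: A_def space_pair_measure)
  ultimately have "emeasure ?Q ((space N - A) \<times> A) = 0"
    by (subst (asm) AE_iff_measurable[OF _ refl]) auto
  then have "N.prob (space N - A) * N.prob A = 0"
    using N.emeasure_pair_measure_Times[of "space N - A" N A]
    by (simp add: N.emeasure_eq_measure flip: ennreal_mult)
  then show ?thesis
    using N.prob_compl[OF A] by (auto simp: A_def)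
qed

section \<open>Quantiles\<close>

text \<open>A Lipschitz function between the indicators of \<open>x > b\<close> and
  \<open>x > a\<close>, through which convergence of expectations bounds tail probabilities.\<close>

definition ramp :: "real \<Rightarrow> real \<Rightarrow> real \<Rightarrow> real" where
  "ramp a b x = max 0 (min 1 ((x - a) / (b - a)))"

lemma ramp_lipschitz:
  assumes "a < b" shows "\<bar>ramp a b x - ramp a b y\<bar> \<le> 1 / (b - a) * \<bar>x - y\<bar>"
proof -
  have 1: "\<bar>max 0 s - max 0 t\<bar> \<le> \<bar>s - t\<bar>" for s t :: real by (simp add: max_def)
  have 2: "\<bar>min 1 s - min 1 t\<bar> \<le> \<bar>s - t\<bar>" for s t :: real by (simp add: min_def)
  have "\<bar>ramp a b x - ramp a b y\<bar> \<le> \<bar>(x - a) / (b - a) - (y - a) / (b - a)\<bar>"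
    unfolding ramp_def by (rule order_trans[OF 1 2])
  also have "(x - a) / (b - a) - (y - a) / (b - a) = (x - y) / (b - a)" by (simp add: diff_divide_distrib)
  finally show ?thesis using assms by simp
qed

lemma ramp_bounded: "\<bar>ramp a b x\<bar> \<le> 1"
  by (auto simp: ramp_def)

lemma borel_measurable_ramp [measurable]: "ramp a b \<in> borel_measurable borel"
  unfolding ramp_def by measurable

lemma (in prob_space) expectation_ramp_bounds:
  fixes X :: "'a \<Rightarrow> real"
  assumes [measurable]: "X \<in> borel_measurable M" and "a < b"
  shows "prob {\<omega>\<in>space M. X \<omega> > b} \<le> (\<integral>\<omega>. ramp a b (X \<omega>) \<partial>M)"
    and "(\<integral>\<omega>. ramp a b (X \<omega>) \<partial>M) \<le> prob {\<omega>\<in>space M. X \<omega> > a}"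
proof -
  have ind: "integrable M (indicator {\<omega>\<in>space M. X \<omega> > r} :: _ \<Rightarrow> real)" for r
    by (intro integrable_real_indicator) (auto simp: emeasure_eq_measure)
  have int: "integrable M (\<lambda>\<omega>. ramp a b (X \<omega>))"
    by (rule integrable_const_bound[where B = 1]) (auto simp: ramp_bounded)
  have "(\<integral>\<omega>. indicator {\<omega>\<in>space M. X \<omega> > b} \<omega> \<partial>M) \<le> (\<integral>\<omega>. ramp a b (X \<omega>) \<partial>M)"
    using \<open>a < b\<close> by (intro integral_mono ind int) (auto simp: indicator_def ramp_def field_simps)
  then show "prob {\<omega>\<in>space M. X \<omega> > b} \<le> (\<integral>\<omega>. ramp a b (X \<omega>) \<partial>M)" by simp
  have "(\<integral>\<omega>. ramp a b (X \<omega>) \<partial>M) \<le> (\<integral>\<omega>. indicator {\<omega>\<in>space M. X \<omega> > a} \<omega> \<partial>M)"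
    using \<open>a < b\<close> by (intro integral_mono ind int) (auto simp: indicator_def ramp_def divide_nonpos_pos)
  then show "(\<integral>\<omega>. ramp a b (X \<omega>) \<partial>M) \<le> prob {\<omega>\<in>space M. X \<omega> > a}" by simp
qed

text \<open>Guards the infimum in \<open>upper_quantile\<close> against an empty or unbounded set.
  Tail probabilities tend to 0, hence fall below \<open>\<alpha> > 0\<close>.\<close>

lemma (in prob_space) upper_quantile_set:
  fixes X :: "'a \<Rightarrow> real"
  assumes [measurable]: "X \<in> borel_measurable M" and "0 < \<alpha>"
  defines "S \<equiv> {r. 0 \<le> r \<and> measure M {\<omega>\<in>space M. X \<omega> > r} \<le> \<alpha>}"
  shows "S \<noteq> {}" "bdd_below S"
proof -
  have "(\<lambda>n. prob {\<omega>\<in>space M. X \<omega> > real n}) \<longlonglongrightarrow> prob (\<Inter>n. {\<omega>\<in>space M. X \<omega> > real n})"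
    by (rule finite_Lim_measure_decseq) (auto simp: decseq_def)
  moreover have "(\<Inter>n. {\<omega>\<in>space M. X \<omega> > real n}) = {}"
    by auto (metis not_less real_arch_simple)
  ultimately have "(\<lambda>n. prob {\<omega>\<in>space M. X \<omega> > real n}) \<longlonglongrightarrow> 0" by simp
  then have "\<forall>\<^sub>F n in sequentially. prob {\<omega>\<in>space M. X \<omega> > real n} < \<alpha>"
    using \<open>0 < \<alpha>\<close> by (rule order_tendstoD)
  then obtain n where "prob {\<omega>\<in>space M. X \<omega> > real n} < \<alpha>" by (auto dest: eventually_happens)
  then have "real n \<in> S" by (simp add: S_def)
  then show "S \<noteq> {}" by blast
  show "bdd_below S" by (auto simp: S_def intro: bdd_belowI[of _ 0])
qed

text \<open>The two directions differ. At nonnegative levels left of the quantile the tail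
  probability exceeds \<open>\<alpha>\<close> by definition of the infimum. To the right it is a
  priori only at most \<open>\<alpha>\<close>, and a flat stretch at that level could hold the
  approximating quantiles away; \<open>gap\<close> excludes it.\<close>

lemma upper_quantile_tendsto:
  fixes X :: "nat \<Rightarrow> 'c \<Rightarrow> real" and Z :: "'b \<Rightarrow> real"
  assumes Q: "\<And>n. prob_space (Q n)" and X: "\<And>n. X n \<in> borel_measurable (Q n)"
    and "prob_space P" and Z [measurable]: "Z \<in> borel_measurable P"
    and conv: "\<And>a b. a < b \<Longrightarrow> (\<lambda>n. \<integral>\<omega>. ramp a b (X n \<omega>) \<partial>Q n) \<longlonglongrightarrow> (\<integral>\<omega>. ramp a b (Z \<omega>) \<partial>P)"
    and gap: "\<And>a b. a < b \<Longrightarrow> AE \<omega> in P. \<not> (a < Z \<omega> \<and> Z \<omega> < b) \<Longrightarrow>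
       measure P {\<omega>\<in>space P. Z \<omega> > a} \<in> {0, 1}"
    and \<alpha>: "0 < \<alpha>" "\<alpha> < 1"
  shows "(\<lambda>n. upper_quantile \<alpha> (Q n) (X n)) \<longlonglongrightarrow> upper_quantile \<alpha> P Z"
proof -
  interpret P: prob_space P by fact
  define S where "S = {r. 0 \<le> r \<and> P.prob {\<omega>\<in>space P. Z \<omega> > r} \<le> \<alpha>}"
  define T where "T n = {r. 0 \<le> r \<and> measure (Q n) {\<omega>\<in>space (Q n). X n \<omega> > r} \<le> \<alpha>}" for n
  have q: "upper_quantile \<alpha> P Z = Inf S" "upper_quantile \<alpha> (Q n) (X n) = Inf (T n)" for n
    by (simp_all add: upper_quantile_def S_def T_def)
  have S: "S \<noteq> {}" "bdd_below S" using P.upper_quantile_set[OF Z \<alpha>(1)] by (auto simp: S_def)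
  have T: "T n \<noteq> {}" "bdd_below (T n)" for n
    using prob_space.upper_quantile_set[OF Q X \<alpha>(1)] by (auto simp: T_def)
  have nonneg: "0 \<le> Inf S" "0 \<le> Inf (T n)" for n using S T by (auto intro!: cInf_greatest simp: S_def T_def)
  have anti: "P.prob {\<omega>\<in>space P. Z \<omega> > s} \<le> P.prob {\<omega>\<in>space P. Z \<omega> > r}" if "r \<le> s" for r s
    using that by (intro P.finite_measure_mono) auto
  have anti': "measure (Q n) {\<omega>\<in>space (Q n). X n \<omega> > s} \<le> measure (Q n) {\<omega>\<in>space (Q n). X n \<omega> > r}"
    if "r \<le> s" for r s n
  proof -
    interpret Q: prob_space "Q n" by (rule Q)
    note X[measurable]
    show ?thesis using that by (intro Q.finite_measure_mono) auto
  qed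
  \<comment> \<open>If the tail probability were still \<open>\<alpha>\<close> at \<open>r\<close>,
    it would be \<open>\<alpha>\<close> at some \<open>s\<close> in \<open>S\<close> below
    \<open>r\<close> as well. Then \<open>(s, r)\<close> carries no mass, and \<open>gap\<close>
    forces \<open>\<alpha>\<close> to be 0 or 1.\<close>
  have strict: "P.prob {\<omega>\<in>space P. Z \<omega> > r} < \<alpha>" if "r > Inf S" for r
  proof (rule ccontr)
    assume *: "\<not> P.prob {\<omega>\<in>space P. Z \<omega> > r} < \<alpha>"
    obtain s where s: "s \<in> S" "s < r" using cInf_lessD[OF S(1) \<open>r > Inf S\<close>] by blast
    then have "P.prob {\<omega>\<in>space P. Z \<omega> > s} \<le> \<alpha>" by (simp add: S_def)
    with * anti[of s r] s have eq: "P.prob {\<omega>\<in>space P. Z \<omega> > s} = \<alpha>" "P.prob {\<omega>\<in>space P. Z \<omega> > r} = \<alpha>"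
      by auto
    have "P.prob ({\<omega>\<in>space P. Z \<omega> > s} - {\<omega>\<in>space P. Z \<omega> > r}) = 0"
      using eq s by (subst P.finite_measure_Diff) auto
    then have "AE \<omega> in P. \<omega> \<notin> {\<omega>\<in>space P. Z \<omega> > s} - {\<omega>\<in>space P. Z \<omega> > r}"
      by (subst (asm) P.prob_eq_0) auto
    then have "AE \<omega> in P. \<not> (s < Z \<omega> \<and> Z \<omega> < r)" by (rule AE_mp) (auto intro!: AE_I2)
    from gap[OF s(2) this] eq \<alpha> show False by auto
  qed
  show ?thesis unfolding q
  proof (rule order_tendstoI)
    fix y assume y: "y > Inf S"
    then obtain r2 where r2: "Inf S < r2" "r2 < y" using dense by blast
    then obtain r1 where r1: "Inf S < r1" "r1 < r2" using dense by blast
    have "(\<integral>\<omega>. ramp r1 r2 (Z \<omega>) \<partial>P) < \<alpha>"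
      using P.expectation_ramp_bounds(2)[OF Z r1(2)] strict[OF r1(1)] by simp
    then have "\<forall>\<^sub>F n in sequentially. (\<integral>\<omega>. ramp r1 r2 (X n \<omega>) \<partial>Q n) < \<alpha>"
      by (rule order_tendstoD(2)[OF conv[OF r1(2)]])
    then show "\<forall>\<^sub>F n in sequentially. Inf (T n) < y"
    proof eventually_elim
      case (elim n)
      then have "r2 \<in> T n"
        using prob_space.expectation_ramp_bounds(1)[OF Q X r1(2), of n] r2 nonneg(1) by (auto simp: T_def)
      then have "Inf (T n) \<le> r2" using T(2) by (rule cInf_lower)
      then show ?case using r2 by simp
    qed
  next
    fix y assume y: "y < Inf S"
    show "\<forall>\<^sub>F n in sequentially. y < Inf (T n)"
    \<comment> \<open>Negative levels are excluded from \<open>S\<close> whatever their tail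
      probability, so \<open>r2 \<notin> S\<close> yields a tail above \<open>\<alpha>\<close> only
      when \<open>r2\<close> is nonnegative.\<close>
    proof (cases "y < 0")
      case True
      then show ?thesis using nonneg(2) by (intro always_eventually allI) (rule less_le_trans)
    next
      case False
      obtain r2 where r2: "y < r2" "r2 < Inf S" using y dense by blast
      then obtain r1 where r1: "y < r1" "r1 < r2" using dense by blast
      have "r2 \<notin> S" using r2 cInf_lower[OF _ S(2), of r2] by auto
      then have "P.prob {\<omega>\<in>space P. Z \<omega> > r2} > \<alpha>" using False r2 by (simp add: S_def)
      then have "(\<integral>\<omega>. ramp r1 r2 (Z \<omega>) \<partial>P) > \<alpha>"
        using P.expectation_ramp_bounds(1)[OF Z r1(2)] by simp
      then have "\<forall>\<^sub>F n in sequentially. (\<integral>\<omega>. ramp r1 r2 (X n \<omega>) \<partial>Q n) > \<alpha>"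
        by (rule order_tendstoD(1)[OF conv[OF r1(2)]])
      then show ?thesis
      proof eventually_elim
        case (elim n)
        then have *: "measure (Q n) {\<omega>\<in>space (Q n). X n \<omega> > r1} > \<alpha>"
          using prob_space.expectation_ramp_bounds(2)[OF Q X r1(2), of n] by simp
        have "r1 \<le> Inf (T n)"
        proof (rule cInf_greatest[OF T(1)])
          fix s assume "s \<in> T n"
          then show "r1 \<le> s" using * anti'[of s r1 n] by (force simp: T_def)
        qed
        then show ?case using r1 by simp
      qed
    qed
  qed
qed

theorem multinomial_gaussian_quantile_tendsto:
  fixes N :: "nat \<Rightarrow> 'c measure" and P :: "'b measure"
  assumes Y: "\<And>n. multinomial_gaussian (f n) (N n) (Y n)" and V: "multinomial_gaussian g P V"
    and f: "\<And>n. f n \<in> prob_vectors" and g: "g \<in> prob_vectors"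
    and lim: "\<And>j. (\<lambda>n. f n j) \<longlonglongrightarrow> g j" and \<alpha>: "0 < \<alpha>" "\<alpha> < 1"
  shows "(\<lambda>n. upper_quantile \<alpha> (N n) (\<lambda>\<omega>. lp_norm \<infinity> (Y n \<omega>)))
    \<longlonglongrightarrow> upper_quantile \<alpha> P (\<lambda>\<omega>. lp_norm \<infinity> (V \<omega>))"
proof (rule upper_quantile_tendsto)
  have Y': "multinomial_process (f n) (N n) (Y n)" for n by (rule multinomial_gaussian_process[OF Y f])
  have V': "multinomial_process g P V" by (rule multinomial_gaussian_process[OF V g])
  show "prob_space (N n)" "(\<lambda>\<omega>. lp_norm \<infinity> (Y n \<omega>)) \<in> borel_measurable (N n)" for n
    by (rule multinomial_process_prob_space[OF Y'], rule borel_measurable_lp_norm_inf[OF Y'])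
  show "prob_space P" "(\<lambda>\<omega>. lp_norm \<infinity> (V \<omega>)) \<in> borel_measurable P"
    by (rule multinomial_process_prob_space[OF V'], rule borel_measurable_lp_norm_inf[OF V'])
  show "(\<lambda>n. \<integral>\<omega>. ramp a b (lp_norm \<infinity> (Y n \<omega>)) \<partial>N n) \<longlonglongrightarrow> (\<integral>\<omega>. ramp a b (lp_norm \<infinity> (V \<omega>)) \<partial>P)"
    if "a < b" for a b
    using that by (intro expectation_sup_norm_tendsto[OF Y' V' f g lim ramp_lipschitz _ ramp_bounded]) auto
  have "(\<integral>\<omega>. (V \<omega> j)\<^sup>2 \<partial>P) \<le> g j" for j
    using multinomial_gaussian_moments(2)[OF V, of j j] by (simp add: power2_eq_square)
  then show "measure P {\<omega>\<in>space P. lp_norm \<infinity> (V \<omega>) > a} \<in> {0, 1}"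
    if "a < b" "AE \<omega> in P. \<not> (a < lp_norm \<infinity> (V \<omega>) \<and> lp_norm \<infinity> (V \<omega>) < b)" for a b
    using sup_norm_gap_zero_one[OF V' _ g that] by blast
qed (use \<alpha> in auto)

section \<open>Empirical frequencies\<close>

text \<open>Hoeffding's bound is geometric in \<open>n\<close> with ratio
  \<open>exp (- 2 * e\<^sup>2)\<close>, so the deviation probabilities are summable for each
  tolerance. Countably many tolerances suffice.\<close>

lemma (in prob_space) strong_law_unit_interval:
  fixes X :: "nat \<Rightarrow> 'a \<Rightarrow> real"
  assumes indep: "indep_vars (\<lambda>_. borel) X {1..}"
    and bnd: "\<And>i \<omega>. i \<ge> 1 \<Longrightarrow> \<omega> \<in> space M \<Longrightarrow> X i \<omega> \<in> {0..1}"
    and mean: "\<And>i. i \<ge> 1 \<Longrightarrow> expectation (X i) = \<mu>"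
  shows "AE \<omega> in M. (\<lambda>n. (\<Sum>i=1..n. X i \<omega>) / real n) \<longlonglongrightarrow> \<mu>"
proof -
  have X [measurable]: "X i \<in> borel_measurable M" if "i \<ge> 1" for i
    using indep that by (auto simp: indep_vars_def)
  have close: "AE \<omega> in M. \<forall>\<^sub>F n in sequentially. \<bar>(\<Sum>i=1..n. X i \<omega>) / real n - \<mu>\<bar> < e" if "e > 0" for e
  proof -
    define A where "A n = {\<omega>\<in>space M. \<bar>(\<Sum>i=1..n. X i \<omega>) - real n * \<mu>\<bar> \<ge> real n * e}" for n
    have A: "A n \<in> sets M" for n unfolding A_def by measurable
    have "prob (A n) \<le> 2 * exp (- 2 * e\<^sup>2) ^ n" for n
    proof (cases "n = 0")
      case True
      show ?thesis unfolding True power_0 using prob_le_1[of "A 0"] by linarith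
    next
      case False
      interpret H: Hoeffding_ineq M "{1..n}" X "\<lambda>_. 0" "\<lambda>_. 1" "\<Sum>i\<in>{1..n}. expectation (X i)"
      proof unfold_locales
        show "indep_vars (\<lambda>_. borel) X {1..n}" by (rule indep_vars_subset[OF indep]) auto
        show "AE \<omega> in M. X i \<omega> \<in> {0..1}" if "i \<in> {1..n}" for i using that bnd by (intro AE_I2) auto
      qed auto
      have "(\<Sum>i\<in>{1..n}. expectation (X i)) = real n * \<mu>" using mean by simp
      then have "prob (A n) \<le> 2 * exp (- 2 * (real n * e)\<^sup>2 / (\<Sum>i\<in>{1..n}. (1 - 0)\<^sup>2))"
        using H.Hoeffding_ineq_abs_ge[of "real n * e"] \<open>e > 0\<close> False by (simp add: A_def)
      also have "- 2 * (real n * e)\<^sup>2 / (\<Sum>i\<in>{1..n}. (1 - 0)\<^sup>2) = real n * (- 2 * e\<^sup>2)"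
        using False by (simp add: power2_eq_square)
      finally show ?thesis by (simp only: exp_of_nat_mult)
    qed
    then have bound: "norm (prob (A n)) \<le> 2 * exp (- 2 * e\<^sup>2) ^ n" for n by simp
    have "norm (exp (- 2 * e\<^sup>2)) < 1" using \<open>e > 0\<close> by simp
    then have "summable (\<lambda>n. 2 * exp (- 2 * e\<^sup>2) ^ n)" by (intro summable_mult summable_geometric)
    then have "summable (\<lambda>n. prob (A n))" by (rule summable_comparison_test'[where N = 0]) (rule bound)
    then have "AE \<omega> in M. \<forall>\<^sub>F n in sequentially. \<omega> \<in> space M - A n"
      using A by (intro borel_cantelli_AE1) (auto simp: emeasure_eq_measure)
    then show ?thesis
    proof eventually_elim
      case (elim \<omega>)
      then show ?case using eventually_gt_at_top[of 0]
      proof eventually_elim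
        case (elim n)
        then have "\<bar>(\<Sum>i=1..n. X i \<omega>) - real n * \<mu>\<bar> < real n * e" by (auto simp: A_def)
        moreover have "(\<Sum>i=1..n. X i \<omega>) / real n - \<mu> = ((\<Sum>i=1..n. X i \<omega>) - real n * \<mu>) / real n"
          using elim by (simp add: field_simps)
        ultimately show ?case using elim by (simp add: field_simps)
      qed
    qed
  qed
  have "AE \<omega> in M. \<forall>k. \<forall>\<^sub>F n in sequentially. \<bar>(\<Sum>i=1..n. X i \<omega>) / real n - \<mu>\<bar> < 1 / real (Suc k)"
    unfolding AE_all_countable by (intro allI close) simp
  then show ?thesis
  proof eventually_elim
    case (elim \<omega>)
    show ?case
    proof (rule tendstoI)
      fix e :: real assume "e > 0"
      then obtain k where "1 / real (Suc k) < e" by (rule nat_approx_posE)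
      then show "\<forall>\<^sub>F n in sequentially. dist ((\<Sum>i=1..n. X i \<omega>) / real n) \<mu> < e"
        using elim[rule_format, of k] by (auto simp: dist_real_def elim: eventually_mono)
    qed
  qed
qed

lemma frequencies_tendsto:
  assumes "prob_space M"
    and indep: "prob_space.indep_vars M (\<lambda>_. count_space (range s)) z {1..}"
    and law: "\<And>i. i \<ge> 1 \<Longrightarrow> measure M {\<omega> \<in> space M. z i \<omega> = s j} = p j"
  shows "AE \<omega> in M. (\<lambda>n. emp n (freq s z n \<omega>) j) \<longlonglongrightarrow> p j"
proof -
  interpret prob_space M by fact
  have "indep_vars (\<lambda>_. borel) (\<lambda>i \<omega>. of_bool (z i \<omega> = s j) :: real) {1..}"
    by (rule indep_vars_compose2[OF indep]) simp
  moreover have "expectation (\<lambda>\<omega>. of_bool (z i \<omega> = s j) :: real) = p j" if "i \<ge> 1" for i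
  proof -
    have "z i \<in> measurable M (count_space (range s))" using indep that by (auto simp: indep_vars_def)
    then have "z i -` {s j} \<inter> space M \<in> sets M" by (rule measurable_sets) auto
    also have "z i -` {s j} \<inter> space M = {\<omega>\<in>space M. z i \<omega> = s j}" by auto
    finally have [measurable]: "{\<omega>\<in>space M. z i \<omega> = s j} \<in> sets M" .
    have "expectation (\<lambda>\<omega>. of_bool (z i \<omega> = s j) :: real) = expectation (indicator {\<omega>\<in>space M. z i \<omega> = s j})"
      by (intro Bochner_Integration.integral_cong) (auto simp: indicator_def)
    then show ?thesis using law[OF that] by simp
  qed
  ultimately have "AE \<omega> in M. (\<lambda>n. (\<Sum>i=1..n. of_bool (z i \<omega> = s j)) / real n) \<longlonglongrightarrow> p j"
    by (intro strong_law_unit_interval) auto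
  then show ?thesis by (simp add: emp_def freq_def)
qed

text \<open>Each observation has exactly one category index; counting the pairs of observations and
  occupied categories in both orders gives the total \<open>n\<close>.\<close>

lemma freq_data_freq:
  assumes "inj s" and "\<And>i. i \<in> {1..n} \<Longrightarrow> z i \<omega> \<in> range s"
  shows "freq_data n (freq s z n \<omega>)"
proof -
  have "\<forall>i\<in>{1..n}. \<exists>j. z i \<omega> = s j" using assms(2) by blast
  then obtain c where c: "\<And>i. i \<in> {1..n} \<Longrightarrow> z i \<omega> = s (c i)" by metis
  have x: "freq s z n \<omega> j = (\<Sum>i=1..n. of_bool (c i = j))" for j
    unfolding freq_def using c by (intro sum.cong) (auto simp: inj_eq[OF assms(1)])
  have supp: "{j. freq s z n \<omega> j > 0} = c ` {1..n}"
    by (auto simp: x simp flip: neq0_conv)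
  have "(\<Sum>j\<in>c ` {1..n}. freq s z n \<omega> j) = (\<Sum>i=1..n. \<Sum>j\<in>c ` {1..n}. of_bool (c i = j))"
    unfolding x by (rule sum.swap)
  also have "\<dots> = (\<Sum>i=1..n. 1)"
    by (intro sum.cong refl) (auto simp: of_bool_def)
  finally show ?thesis by (simp add: freq_data_def supp)
qed

section \<open>Probability vectors and convergence in \<open>\<ell>\<^sub>1\<close>\<close>

lemma prob_vectors_le_1: "f \<in> prob_vectors \<Longrightarrow> f j \<le> 1"
  using sum_le_suminf[of f "{j}"] by (auto simp: prob_vectors_def sums_iff)

lemma prob_vectors_nonneg: "f \<in> prob_vectors \<Longrightarrow> 0 \<le> f j"
  by (simp add: prob_vectors_def)

lemma prob_vectors_diff_le_1:
  assumes "f \<in> prob_vectors" "h \<in> prob_vectors" shows "\<bar>f j - h j\<bar> \<le> 1"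
  using prob_vectors_le_1[OF assms(1), of j] prob_vectors_le_1[OF assms(2), of j]
    prob_vectors_nonneg[OF assms(1), of j] prob_vectors_nonneg[OF assms(2), of j] by linarith

lemma prob_vectors_summable_diff:
  assumes "f \<in> prob_vectors" "h \<in> prob_vectors" shows "summable (\<lambda>j. \<bar>f j - h j\<bar>)"
proof (rule summable_comparison_test'[where N = 0])
  show "summable (\<lambda>j. f j + h j)" using assms by (auto simp: prob_vectors_def sums_iff intro: summable_add)
  show "norm \<bar>f j - h j\<bar> \<le> f j + h j" for j
    using prob_vectors_nonneg[OF assms(1), of j] prob_vectors_nonneg[OF assms(2), of j] by auto
qed

lemma prob_vectors_convex:
  assumes "f \<in> prob_vectors" "h \<in> prob_vectors" "0 \<le> b" "b \<le> 1"
  shows "(\<lambda>j. b * f j + (1 - b) * h j) \<in> prob_vectors"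
proof -
  have "(\<lambda>j. b * f j + (1 - b) * h j) sums (b * 1 + (1 - b) * 1)"
    using assms by (intro sums_add sums_mult) (auto simp: prob_vectors_def)
  then show ?thesis using assms by (auto simp: prob_vectors_def)
qed

text \<open>The deficits \<open>max 0 (p j - f n j)\<close> are dominated by \<open>p\<close>,
  unlike the differences themselves. Both totals being 1, surplus and deficit balance, and the
  \<open>\<ell>\<^sub>1\<close> distance is twice the deficit.\<close>

lemma scheffe_prob_vectors:
  assumes f: "\<And>n. f n \<in> prob_vectors" and p: "p \<in> prob_vectors"
    and lim: "\<And>j. (\<lambda>n. f n j) \<longlonglongrightarrow> p j"
  shows "(\<lambda>n. \<Sum>j. \<bar>f n j - p j\<bar>) \<longlonglongrightarrow> 0"
proof -
  let ?m = "\<lambda>j n. max 0 (p j - f n j)"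
  have p': "summable p" "suminf p = 1" and f': "summable (f n)" "suminf (f n) = 1" for n
    using p f by (auto simp: prob_vectors_def sums_iff)
  have bound: "norm (?m j n) \<le> p j" for j n
    using prob_vectors_nonneg[OF p, of j] prob_vectors_nonneg[OF f, of n j] by auto
  have m: "summable (\<lambda>j. ?m j n)" for n
    by (rule summable_comparison_test'[OF p'(1), of 0]) (rule bound)
  have "(\<lambda>n. \<Sum>j. ?m j n) \<longlonglongrightarrow> (\<Sum>j. 0)"
  proof (intro conjunct2[OF conjunct2[OF tannerys_theorem[where M = p]]])
    show "(\<lambda>n. ?m j n) \<longlonglongrightarrow> 0" for j
      using tendsto_max[OF tendsto_const tendsto_diff[OF tendsto_const lim[of j]], of 0 "p j"] by simp
  qed (use bound p' in \<open>auto intro!: always_eventually\<close>)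
  then have "(\<lambda>n. 2 * (\<Sum>j. ?m j n)) \<longlonglongrightarrow> 2 * 0" by (intro tendsto_intros) simp
  moreover have "(\<Sum>j. \<bar>f n j - p j\<bar>) = 2 * (\<Sum>j. ?m j n)" for n
  proof -
    have "(\<Sum>j. \<bar>f n j - p j\<bar>) = (\<Sum>j. (f n j - p j) + 2 * ?m j n)"
      by (intro suminf_cong) (auto simp: max_def)
    also have "\<dots> = (suminf (f n) - suminf p) + 2 * (\<Sum>j. ?m j n)"
      using m f'(1) p'(1) by (subst suminf_add[symmetric]) (auto simp: suminf_diff suminf_mult intro: summable_diff summable_mult)
    finally show ?thesis by (simp add: f' p')
  qed
  ultimately show ?thesis by simp
qed

section \<open>Frequency data and leave-one-out frequencies\<close>

context
  fixes n :: nat and x :: "nat \<Rightarrow> nat"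
  assumes data: "freq_data n x"
begin

lemma freq_data_outside: "j > last_index x \<Longrightarrow> x j = 0"
proof (rule ccontr)
  assume "j > last_index x" "x j \<noteq> 0"
  moreover have "bdd_above {j. x j > 0}" using data by (auto simp: freq_data_def)
  ultimately show False using cSup_upper[of j "{j. x j > 0}"] by (auto simp: last_index_def)
qed

lemma freq_data_sum: "(\<Sum>j=0..last_index x. x j) = n"
proof -
  have "(\<Sum>j=0..last_index x. x j) = (\<Sum>j | x j > 0. x j)"
    by (rule sum.mono_neutral_right) (auto simp: freq_data_outside simp flip: not_less)
  then show ?thesis using data by (simp add: freq_data_def)
qed

lemma freq_data_le: "x j \<le> n"
proof (cases "x j = 0")
  case False
  then have "j \<in> {0..last_index x}" using freq_data_outside[of j] by force
  then have "x j \<le> (\<Sum>j=0..last_index x. x j)" by (intro member_le_sum) auto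
  then show ?thesis by (simp add: freq_data_sum)
qed simp

lemma freq_data_sums:
  assumes "\<And>j. x j = 0 \<Longrightarrow> h j = (0::real)"
  shows "h sums (\<Sum>j=0..last_index x. h j)"
  using assms freq_data_outside by (intro sums_finite) auto

lemma emp_prob_vector: "n \<ge> 1 \<Longrightarrow> emp n x \<in> prob_vectors"
  using freq_data_sums[of "emp n x"] arg_cong[OF freq_data_sum, of real]
  by (auto simp: prob_vectors_def emp_def simp flip: sum_divide_distrib)

lemma emp_loo_prob_vector:
  assumes "n \<ge> 2" "x j > 0"
  shows "emp_loo n x j \<in> prob_vectors"
proof -
  have j: "j \<in> {0..last_index x}" using freq_data_outside[of j] assms by force
  have "(\<lambda>k. real (x k) - unit_seq j k) sums (\<Sum>k=0..last_index x. real (x k) - unit_seq j k)"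
    by (rule freq_data_sums) (use assms in \<open>auto simp: unit_seq_def\<close>)
  also have "(\<Sum>k=0..last_index x. real (x k) - unit_seq j k) = real n - 1"
    using j arg_cong[OF freq_data_sum, of real] by (simp add: sum_subtractf unit_seq_def of_bool_def)
  finally have "emp_loo n x j sums ((real n - 1) / (real n - 1))"
    unfolding emp_loo_def by (rule sums_divide)
  moreover have "0 \<le> emp_loo n x j k" for k
    using assms by (auto simp: emp_loo_def unit_seq_def intro!: divide_nonneg_nonneg)
  ultimately show ?thesis using assms by (simp add: prob_vectors_def)
qed

text \<open>The difference is \<open>(x k / n - unit_seq j k) / (n - 1)\<close>, whose numerator is
  at most 1 in absolute value; the bound is uniform in \<open>j\<close> and
  \<open>k\<close>.\<close>

lemma emp_loo_near:
  assumes "n \<ge> 2" shows "\<bar>emp_loo n x j k - emp n x k\<bar> \<le> 1 / (real n - 1)"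
proof -
  have n: "real n > 1" using assms by simp
  then have "emp_loo n x j k - emp n x k = (real (x k) / real n - unit_seq j k) / (real n - 1)"
    by (simp add: emp_loo_def emp_def divide_simps) (simp add: algebra_simps)
  moreover have "real (x k) / real n \<le> 1" "0 \<le> real (x k) / real n"
    using freq_data_le[of k] n by auto
  then have "\<bar>real (x k) / real n - unit_seq j k\<bar> \<le> 1" by (auto simp: unit_seq_def)
  ultimately show ?thesis using n by (simp add: divide_right_mono)
qed

lemma emp_loo_near_loo:
  assumes "n \<ge> 2" shows "\<bar>emp_loo n x i k - emp_loo n x j k\<bar> \<le> 1 / (real n - 1)"
proof -
  have "emp_loo n x i k - emp_loo n x j k = (unit_seq j k - unit_seq i k) / (real n - 1)"
    by (simp add: emp_loo_def flip: diff_divide_distrib)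
  moreover have "\<bar>unit_seq j k - unit_seq i k\<bar> \<le> 1" by (simp add: unit_seq_def)
  ultimately show ?thesis using assms by (simp add: divide_right_mono)
qed

end

lemma mixture_param_bounds: "0 \<le> mixture_param d \<Psi> n x" "mixture_param d \<Psi> n x \<le> 1"
  by (auto simp: mixture_param_def beta_L1_def beta_L2_def Let_def divide_le_eq_1)

section \<open>The stacked estimator\<close>

text \<open>Turns the contraction into coordinatewise estimates, so that boundedness of the suprema
  is checked here once.\<close>

lemma sup_contraction_pointwise:
  assumes "lp_norm \<infinity> (\<lambda>j. u j - v j) \<le> lp_norm \<infinity> (\<lambda>j. f j - h j)"
    and "u \<in> prob_vectors" "v \<in> prob_vectors" and D: "\<And>k. \<bar>f k - h k\<bar> \<le> D"
  shows "\<bar>u k - v k\<bar> \<le> D"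
proof -
  have "bdd_above (range (\<lambda>j. \<bar>u j - v j\<bar>))"
    using prob_vectors_diff_le_1[OF assms(2,3)] by (auto simp: bdd_above_def)
  then have "\<bar>u k - v k\<bar> \<le> (SUP j. \<bar>u j - v j\<bar>)" by (intro cSUP_upper) auto
  also have "\<dots> \<le> (SUP j. \<bar>f j - h j\<bar>)" using assms(1) by (simp add: lp_norm_def)
  also have "\<dots> \<le> D" by (intro cSUP_least D) auto
  finally show ?thesis .
qed

text \<open>One sample size and one frequency vector, so all estimates are deterministic.
  \<open>S\<close> is the \<open>\<ell>\<^sub>1\<close> error of the observed frequencies; it serves
  both as a uniform bound on coordinates and to exchange weights in sums.\<close>

locale loo_data =
  fixes \<Psi> :: "(nat \<Rightarrow> real) \<Rightarrow> nat \<Rightarrow> real" and p :: "nat \<Rightarrow> real" and n :: nat and x :: "nat \<Rightarrow> nat"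
    and S :: real
  assumes maps: "\<And>f. f \<in> prob_vectors \<Longrightarrow> \<Psi> f \<in> prob_vectors"
    and contr: "\<And>f h. f \<in> prob_vectors \<Longrightarrow> h \<in> prob_vectors \<Longrightarrow>
      lp_norm \<infinity> (\<lambda>j. \<Psi> f j - \<Psi> h j) \<le> lp_norm \<infinity> (\<lambda>j. f j - h j)"
    and p: "p \<in> prob_vectors" and data: "freq_data n x" and n: "n \<ge> 2"
    and S_def: "S = (\<Sum>j. \<bar>emp n x j - p j\<bar>)"
begin

abbreviation "G \<equiv> g_loo \<Psi> n x"

lemma emp: "emp n x \<in> prob_vectors"
  using emp_prob_vector[OF data] n by simp

lemma contr': "f \<in> prob_vectors \<Longrightarrow> h \<in> prob_vectors \<Longrightarrow> (\<And>k. \<bar>f k - h k\<bar> \<le> D) \<Longrightarrow> \<bar>\<Psi> f k - \<Psi> h k\<bar> \<le> D"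
  by (rule sup_contraction_pointwise[OF contr]) (auto intro: maps)

lemma emp_near: "\<bar>emp n x k - p k\<bar> \<le> S"
  using sum_le_suminf[OF prob_vectors_summable_diff[OF emp p], of "{k}"] by (simp add: S_def)

lemma G_near: 
  assumes "x j > 0" shows "\<bar>G j k - \<Psi> p k\<bar> \<le> S + 1 / (real n - 1)"
proof -
  have "\<bar>emp_loo n x j k - p k\<bar> \<le> S + 1 / (real n - 1)" for k
    using emp_loo_near[OF data n, of j k] emp_near[of k] by linarith
  then have "\<bar>\<Psi> (emp_loo n x j) k - \<Psi> p k\<bar> \<le> S + 1 / (real n - 1)"
    by (intro contr' emp_loo_prob_vector[OF data n assms] p)
  then show ?thesis using assms by (simp add: g_loo_def)
qed

text \<open>Two leave-one-out samples differ by a single exchanged observation, so the bound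
  involves neither \<open>p\<close> nor \<open>S\<close>; its order \<open>1 / n\<close> is what
  keeps \<open>b_L2\<close> of order \<open>n\<^sup>2\<close>.\<close>

lemma G_near_G:
  assumes "x i > 0" "x j > 0" shows "\<bar>G i k - G j k\<bar> \<le> 1 / (real n - 1)"
  using contr'[OF emp_loo_prob_vector[OF data n assms(1)] emp_loo_prob_vector[OF data n assms(2)]
      emp_loo_near_loo[OF data n]] assms
  by (simp add: g_loo_def)

lemma G_nonneg: "0 \<le> G j k"
  using prob_vectors_nonneg[OF maps[OF emp_loo_prob_vector[OF data n]], of j k] by (simp add: g_loo_def)

lemma freq_eq: "real (x j) = real n * emp n x j"
  using n by (simp add: emp_def)

lemma freq_sum: "(\<Sum>j=0..last_index x. real (x j)) = real n"
  using arg_cong[OF freq_data_sum[OF data], of real] by simp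

lemma emp_sum: "(\<Sum>j=0..last_index x. emp n x j) = 1"
  using freq_sum n by (simp add: emp_def flip: sum_divide_distrib)

text \<open>The summand of the \<open>L\<^sub>1\<close> criterion collapses to \<open>x\<^sub>j\<^sup>2 - (n - 1) x\<^sub>j g\<^sub>j\<^sub>j\<close>.\<close>

lemma criterion_L1_lower:
  "(\<Sum>j=0..last_index x. (real (x j) - real n * G j j)\<^sup>2
      + (real n + 1) * G j j * (real (x j) - real n * G j j) + real n * (G j j)\<^sup>2)
   \<ge> (real n)\<^sup>2 * (ell2_inner p (\<lambda>j. p j - \<Psi> p j) - 3 * S - 1 / (real n - 1))"
proof -
  let ?r = "1 / (real n - 1)" and ?u = "\<lambda>j. p j - \<Psi> p j"
  have u: "\<bar>?u j\<bar> \<le> 1" for j by (rule prob_vectors_diff_le_1[OF p maps[OF p]])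
  \<comment> \<open>\<open>2 * S\<close> comes from replacing \<open>emp n x j\<close> by
    \<open>p j\<close> and \<open>G j j\<close> by \<open>\<Psi> p j\<close>; the third
    \<open>S\<close> of the claim comes from replacing the weights \<open>emp n x\<close> by
    \<open>p\<close>. For an unobserved category the default value 0 of \<open>G\<close> makes both
    sides vanish.\<close>
  have summand: "(real n)\<^sup>2 * (emp n x j * (?u j - (2 * S + ?r)))
    \<le> (real (x j) - real n * G j j)\<^sup>2 + (real n + 1) * G j j * (real (x j) - real n * G j j) + real n * (G j j)\<^sup>2" for j
  proof (cases "x j = 0")
    case True
    then show ?thesis by (simp add: emp_def g_loo_def)
  next
    case False
    then have "?u j - (2 * S + ?r) \<le> emp n x j - G j j"
      using G_near[of j j] emp_near[of j] by linarith
    then have "real (x j) * (real n * (?u j - (2 * S + ?r))) \<le> real (x j) * (real n * (emp n x j - G j j))"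
      by (intro mult_left_mono) auto
    also have "\<dots> = real (x j) * (real (x j) - real n * G j j)" by (simp add: freq_eq right_diff_distrib)
    also have "\<dots> \<le> real (x j) * (real (x j) - (real n - 1) * G j j)"
      using G_nonneg[of j j] by (intro mult_left_mono) (auto simp: algebra_simps)
    also have "\<dots> = (real (x j) - real n * G j j)\<^sup>2 + (real n + 1) * G j j * (real (x j) - real n * G j j) + real n * (G j j)\<^sup>2"
      by (simp add: power2_eq_square algebra_simps)
    finally show ?thesis by (simp add: freq_eq power2_eq_square mult_ac)
  qed
  have sump: "summable (\<lambda>j. p j * ?u j)"
  proof (rule summable_comparison_test'[where N = 0])
    show "summable p" using p by (simp add: prob_vectors_def sums_iff)
    show "norm (p j * ?u j) \<le> p j" for j
      using u[of j] prob_vectors_nonneg[OF p, of j] by (simp add: abs_mult mult_left_le)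
  qed
  have sume: "(\<lambda>j. emp n x j * ?u j) sums (\<Sum>j=0..last_index x. emp n x j * ?u j)"
    by (rule freq_data_sums[OF data]) (simp add: emp_def)
  have "(\<Sum>j. p j * ?u j) - (\<Sum>j=0..last_index x. emp n x j * ?u j) = (\<Sum>j. p j * ?u j - emp n x j * ?u j)"
    unfolding sums_unique[OF sume] by (rule suminf_diff[OF sump sums_summable[OF sume]])
  also have "\<dots> \<le> S"
    unfolding S_def
  proof (rule suminf_le)
    show "p j * ?u j - emp n x j * ?u j \<le> \<bar>emp n x j - p j\<bar>" for j
    proof -
      have "p j * ?u j - emp n x j * ?u j \<le> \<bar>(p j - emp n x j) * ?u j\<bar>" by (simp add: left_diff_distrib)
      also have "\<dots> \<le> \<bar>p j - emp n x j\<bar> * 1" unfolding abs_mult using u by (intro mult_left_mono) auto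
      finally show ?thesis by (simp add: abs_minus_commute)
    qed
    show "summable (\<lambda>j. p j * ?u j - emp n x j * ?u j)" using sume sump by (intro summable_diff) (auto simp: sums_iff)
  qed (rule prob_vectors_summable_diff[OF emp p])
  finally have diff_le: "(\<Sum>j. p j * ?u j) - (\<Sum>j=0..last_index x. emp n x j * ?u j) \<le> S" .
  have distr: "(\<Sum>j\<in>T. w j * v j) - c * sum w T = (\<Sum>j\<in>T. w j * (v j - c))"
    for w v :: "nat \<Rightarrow> real" and c T
    by (simp add: right_diff_distrib sum_subtractf sum_distrib_left mult.commute)
  have "ell2_inner p ?u - S \<le> (\<Sum>j=0..last_index x. emp n x j * ?u j)"
    using diff_le by (simp add: ell2_inner_def)
  then have "ell2_inner p ?u - 3 * S - ?r \<le> (\<Sum>j=0..last_index x. emp n x j * ?u j) - (2 * S + ?r) * (\<Sum>j=0..last_index x. emp n x j)"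
    by (simp add: emp_sum)
  also have "\<dots> = (\<Sum>j=0..last_index x. emp n x j * (?u j - (2 * S + ?r)))"
    by (rule distr)
  finally have "(real n)\<^sup>2 * (ell2_inner p ?u - 3 * S - ?r) \<le> (real n)\<^sup>2 * (\<Sum>j=0..last_index x. emp n x j * (?u j - (2 * S + ?r)))"
    by (rule mult_left_mono) simp
  also have "\<dots> \<le> (\<Sum>j=0..last_index x. (real (x j) - real n * G j j)\<^sup>2
      + (real n + 1) * G j j * (real (x j) - real n * G j j) + real n * (G j j)\<^sup>2)"
    unfolding sum_distrib_left by (intro sum_mono summand)
  finally show ?thesis .
qed

text \<open>A single coordinate \<open>k\<close> of each inner sum of squares is kept. There every
  leave-one-out residual is at least \<open>n * d / 2\<close> with
  \<open>d = p k - \<Psi> p k\<close>; its square is weighted by the \<open>x j\<close>, which sum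
  to \<open>n\<close>. The linear terms cost at most \<open>2 * n\<^sup>2\<close>.\<close>

lemma a_L2_lower:
  assumes \<delta>: "2 * S + 1 / (real n - 1) \<le> (p k - \<Psi> p k) / 2" "p k > \<Psi> p k"
  shows "a_L2 \<Psi> n x \<ge> (real n) ^ 3 * (p k - \<Psi> p k)\<^sup>2 / 4 - 2 * (real n)\<^sup>2"
proof -
  let ?t = "last_index x" and ?d = "p k - \<Psi> p k"
  have summand: "real (x j) * (2 * (real (x j) - G j j * (real n - 1)) - (\<Sum>k=0..?t. (real (x k) - (real n - 1) * G j k)\<^sup>2))
     \<le> real (x j) * (2 * real n - (real n * (?d / 2))\<^sup>2)" for j
  proof (cases "x j = 0")
    case False
    then have "?d / 2 \<le> emp n x k - G j k"
      using \<delta>(1) G_near[of j k] emp_near[of k] by (simp add: abs_le_iff)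
    then have "real n * (?d / 2) \<le> real n * (emp n x k - G j k)" by (intro mult_left_mono) auto
    also have "\<dots> \<le> real (x k) - (real n - 1) * G j k"
      using G_nonneg[of j k] by (simp add: freq_eq algebra_simps)
    finally have le: "real n * (?d / 2) \<le> real (x k) - (real n - 1) * G j k" .
    then have sq: "(real n * (?d / 2))\<^sup>2 \<le> (real (x k) - (real n - 1) * G j k)\<^sup>2"
      using \<delta>(2) by (intro power_mono) auto
    have "0 < real n * (?d / 2)" using \<delta>(2) n by simp
    \<comment> \<open>Category \<open>k\<close> is thereby observed, so its square really occurs in
      a sum that stops at \<open>last_index x\<close>.\<close>
    then have "0 < real (x k)" using le G_nonneg[of j k] n
      by (smt (verit) mult_nonneg_nonneg of_nat_1 of_nat_le_iff one_le_numeral order_trans)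
    then have "k \<in> {0..?t}" using freq_data_outside[OF data, of k] by force
    then have "(real (x k) - (real n - 1) * G j k)\<^sup>2 \<le> (\<Sum>k=0..?t. (real (x k) - (real n - 1) * G j k)\<^sup>2)"
      by (intro member_le_sum[where f = "\<lambda>k. (real (x k) - (real n - 1) * G j k)\<^sup>2"]) auto
    moreover have "real (x j) - G j j * (real n - 1) \<le> real n"
    proof -
      have "0 \<le> G j j * (real n - 1)" using G_nonneg[of j j] n by simp
      moreover have "real (x j) \<le> real n" using freq_data_le[OF data, of j] by simp
      ultimately show ?thesis by linarith
    qed
    ultimately show ?thesis using sq by (intro mult_left_mono) auto
  qed simp
  have "(\<Sum>j=0..?t. real (x j) * (2 * (real (x j) - G j j * (real n - 1)) - (\<Sum>k=0..?t. (real (x k) - (real n - 1) * G j k)\<^sup>2)))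
    \<le> (\<Sum>j=0..?t. real (x j) * (2 * real n - (real n * (?d / 2))\<^sup>2))"
    by (intro sum_mono summand)
  also have "\<dots> = real n * (2 * real n - (real n * (?d / 2))\<^sup>2)"
    by (simp add: freq_sum flip: sum_distrib_right)
  finally have lower: "a_L2 \<Psi> n x \<ge> real n - real n * (2 * real n - (real n * (?d / 2))\<^sup>2)"
    by (simp add: a_L2_def Let_def)
  have cubic: "real n * (2 * real n - (real n * (d / 2))\<^sup>2) = 2 * (real n)\<^sup>2 - (real n) ^ 3 * d\<^sup>2 / 4" for d
    by (simp add: power2_eq_square power3_eq_cube right_diff_distrib)
  show ?thesis using lower unfolding cubic[of ?d] by simp
qed

text \<open>The differences of size \<open>1 / (n - 1)\<close>, weighted twice by frequencies
  summing to \<open>n\<close>, cancel the factor \<open>n - 1\<close> and leave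
  \<open>n\<^sup>2\<close>; the subtracted squares are dropped.\<close>

lemma b_L2_upper: "b_L2 \<Psi> n x \<le> 2 * (real n)\<^sup>2"
proof -
  let ?t = "last_index x"
  have "real (x j) * (\<Sum>k=0..?t. real (x k) * (G k k - G j k)) \<le> real (x j) * (\<Sum>k=0..?t. real (x k) * (1 / (real n - 1)))" for j
  proof (cases "x j = 0")
    case False
    have "real (x k) * (G k k - G j k) \<le> real (x k) * (1 / (real n - 1))" (is "?l k \<le> ?r k") for k
    proof (cases "x k = 0")
      case pos: False
      then have "G k k - G j k \<le> 1 / (real n - 1)" using G_near_G[of k j k] False by simp
      then show ?thesis by (rule mult_left_mono) simp
    qed simp
    then have "sum ?l {0..?t} \<le> sum ?r {0..?t}" by (rule sum_mono)
    then show ?thesis by (rule mult_left_mono) simp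
  qed simp
  then have "(\<Sum>j=0..?t. real (x j) * (\<Sum>k=0..?t. real (x k) * (G k k - G j k)))
    \<le> (\<Sum>j=0..?t. real (x j) * (\<Sum>k=0..?t. real (x k) * (1 / (real n - 1))))"
    by (rule sum_mono)
  also have "\<dots> = (real n)\<^sup>2 / (real n - 1)"
    by (simp only: sum_distrib_right[symmetric] freq_sum) (simp add: power2_eq_square)
  finally have "(real n - 1) * (\<Sum>j=0..?t. real (x j) * (\<Sum>k=0..?t. real (x k) * (G k k - G j k)))
    \<le> (real n - 1) * ((real n)\<^sup>2 / (real n - 1))"
    using n by (intro mult_left_mono) auto
  also have "\<dots> = (real n)\<^sup>2" using n by simp
  finally show ?thesis
    using sum_nonneg[of "{0..?t}" "\<lambda>j. (real (x j))\<^sup>2"] by (simp add: b_L2_def Let_def)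
qed

end

text \<open>A deterministic statement about an arbitrary sequence of frequency data. If
  \<open>\<Psi> p = p\<close>, any weight in \<open>[0, 1]\<close> will do; otherwise the weight
  vanishes and multiplies a difference bounded by 1.\<close>

theorem stacked_tendsto:
  fixes p :: "nat \<Rightarrow> real" and x :: "nat \<Rightarrow> nat \<Rightarrow> nat"
  assumes maps: "\<And>f. f \<in> prob_vectors \<Longrightarrow> \<Psi> f \<in> prob_vectors"
    and contr: "\<And>f h. f \<in> prob_vectors \<Longrightarrow> h \<in> prob_vectors \<Longrightarrow>
      lp_norm \<infinity> (\<lambda>j. \<Psi> f j - \<Psi> h j) \<le> lp_norm \<infinity> (\<lambda>j. f j - h j)"
    and orth: "ell2_inner (\<Psi> p) (\<lambda>j. p j - \<Psi> p j) = 0"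
    and p: "p \<in> prob_vectors" and data: "\<And>n. freq_data n (x n)"
    and lim: "\<And>j. (\<lambda>n. emp n (x n) j) \<longlonglongrightarrow> p j"
  shows "(\<lambda>n. stacked d \<Psi> n (x n) j) \<longlonglongrightarrow> p j"
proof -
  define S where "S n = (\<Sum>j. \<bar>emp n (x n) j - p j\<bar>)" for n
  have loo: "loo_data \<Psi> p n (x n) (S n)" if "n \<ge> 2" for n
    using that by unfold_locales (auto simp: S_def maps contr p data)
  \<comment> \<open>The shift skips the sample size 0, where \<open>emp\<close> is identically 0 and
    not a probability vector.\<close>
  have "(\<lambda>n. S (Suc n)) \<longlonglongrightarrow> 0"
    unfolding S_def by (rule scheffe_prob_vectors[OF _ p]) (auto intro!: emp_prob_vector data LIMSEQ_Suc[OF lim])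
  then have S: "S \<longlonglongrightarrow> 0" by (rule LIMSEQ_imp_Suc)
  have ev2: "\<forall>\<^sub>F n in sequentially. 2 \<le> n" by (rule eventually_ge_at_top)
  show ?thesis
  proof (cases "\<Psi> p = p")
    case True
    have "(\<lambda>n. stacked d \<Psi> n (x n) j - p j) \<longlonglongrightarrow> 0"
    proof (rule Lim_null_comparison[OF _ S])
      show "\<forall>\<^sub>F n in sequentially. norm (stacked d \<Psi> n (x n) j - p j) \<le> S n"
        using ev2
      proof eventually_elim
        case (elim n)
        interpret loo_data \<Psi> p n "x n" "S n" by (rule loo[OF elim])
        let ?b = "mixture_param d \<Psi> n (x n)"
        have "\<bar>\<Psi> (emp n (x n)) j - p j\<bar> \<le> S n"
          using contr'[OF emp p emp_near, of j] True by simp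
        then have "\<bar>?b * (\<Psi> (emp n (x n)) j - p j) + (1 - ?b) * (emp n (x n) j - p j)\<bar> \<le> ?b * S n + (1 - ?b) * S n"
          using mixture_param_bounds[of d \<Psi> n "x n"] emp_near[of j]
          by (intro order_trans[OF abs_triangle_ineq] add_mono) (auto simp: abs_mult intro!: mult_left_mono)
        moreover have "stacked d \<Psi> n (x n) j - p j = ?b * (\<Psi> (emp n (x n)) j - p j) + (1 - ?b) * (emp n (x n) j - p j)"
          by (simp add: stacked_def algebra_simps)
        ultimately show ?case by (simp add: algebra_simps)
      qed
    qed
    then show ?thesis by (rule LIM_zero_cancel)
  next
    case False
    let ?u = "\<lambda>j. p j - \<Psi> p j"
    have bound: "norm (f j * ?u j) \<le> f j" if "f \<in> prob_vectors" for f j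
      using prob_vectors_diff_le_1[OF p maps[OF p], of j] prob_vectors_nonneg[OF that, of j]
      by (simp add: abs_mult mult_left_le)
    have sum: "summable (\<lambda>j. f j * ?u j)" if "f \<in> prob_vectors" for f
      by (rule summable_comparison_test'[where N = 0 and g = f])
         (use that bound[OF that] in \<open>auto simp: prob_vectors_def sums_iff\<close>)
    define H where "H = ell2_inner p ?u"
    have "H = ell2_inner p ?u - ell2_inner (\<Psi> p) ?u" using orth by (simp add: H_def)
    also have "\<dots> = (\<Sum>j. (?u j)\<^sup>2)"
      unfolding ell2_inner_def using sum[OF p] sum[OF maps[OF p]]
      by (subst suminf_diff) (auto simp: power2_eq_square left_diff_distrib)
    finally have H: "H = (\<Sum>j. (?u j)\<^sup>2)" .
    have sumsq: "summable (\<lambda>j. (?u j)\<^sup>2)"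
      using summable_diff[OF sum[OF p] sum[OF maps[OF p]]] by (simp add: power2_eq_square left_diff_distrib)
    obtain i where "p i \<noteq> \<Psi> p i" using False by fastforce
    then have "H > 0" unfolding H by (intro suminf_pos2[OF sumsq, of i]) auto
    have "(\<lambda>n. 1 / (real n - 1)) \<longlonglongrightarrow> 0" by real_asymp
    have \<beta>: "(\<lambda>n. mixture_param d \<Psi> n (x n)) \<longlonglongrightarrow> 0"
    proof (cases "d = 1")
      case True
      have "(\<lambda>n. H - 3 * S n - 1 / (real n - 1)) \<longlonglongrightarrow> H - 3 * 0 - 0"
        by (intro tendsto_intros S) fact
      then have ev1: "\<forall>\<^sub>F n in sequentially. H / 2 < H - 3 * S n - 1 / (real n - 1)"
        using \<open>H > 0\<close> by (intro order_tendstoD(1)) auto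
      have ev3: "\<forall>\<^sub>F n in sequentially. real n \<le> (real n)\<^sup>2 * (H / 2)"
        using \<open>H > 0\<close> by real_asymp
      have "\<forall>\<^sub>F n in sequentially. mixture_param d \<Psi> n (x n) = 0"
        using ev1 ev2 ev3
      proof eventually_elim
        case (elim n)
        interpret loo_data \<Psi> p n "x n" "S n" by (rule loo[OF elim(2)])
        have "real n \<le> (real n)\<^sup>2 * (H - 3 * S n - 1 / (real n - 1))"
          using elim(1) by (intro order_trans[OF elim(3)] mult_left_mono) auto
        also note criterion_L1_lower[folded H_def]
        finally show ?case using True by (simp add: mixture_param_def beta_L1_def Let_def)
      qed
      then show ?thesis by (rule tendsto_eventually)
    next
      case d: False
      have "\<exists>k. p k * ?u k > 0"
      proof (rule ccontr)
        assume "\<nexists>k. p k * ?u k > 0"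
        then have "p k * ?u k \<le> 0" for k by (simp add: not_less)
        then have "H \<le> 0" unfolding H_def ell2_inner_def by (intro suminf_le_const[OF sum[OF p]] sum_nonpos) auto
        with \<open>H > 0\<close> show False by simp
      qed
      then obtain k where "p k * ?u k > 0" by blast
      then have k: "p k > \<Psi> p k" using prob_vectors_nonneg[OF p, of k] by (simp add: zero_less_mult_iff)
      define \<delta> where "\<delta> = ?u k"
      have \<delta>: "\<delta> > 0" using k by (simp add: \<delta>_def)
      have "(\<lambda>n. 2 * S n + 1 / (real n - 1)) \<longlonglongrightarrow> 2 * 0 + 0"
        by (intro tendsto_intros S) fact
      then have ev1: "\<forall>\<^sub>F n in sequentially. 2 * S n + 1 / (real n - 1) < \<delta> / 2"
        using \<delta> by (intro order_tendstoD(2)) auto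
      \<comment> \<open>Used twice: it leaves at least half of the cubic term in the lower bound for
        \<open>a_L2\<close>, and it gives \<open>b_L2 \<le> a_L2\<close>, which rules out the branch
        with weight 1. The constant 16 below is 2 divided by 1/8.\<close>
      have ev3: "\<forall>\<^sub>F n in sequentially. 2 * (real n)\<^sup>2 \<le> real n ^ 3 * \<delta>\<^sup>2 / 8"
        using \<delta> by real_asymp
      have "(\<lambda>n. 16 / (\<delta>\<^sup>2 * real n)) \<longlonglongrightarrow> 0" using \<delta> by real_asymp
      moreover have "\<forall>\<^sub>F n in sequentially. norm (mixture_param d \<Psi> n (x n)) \<le> 16 / (\<delta>\<^sup>2 * real n)"
        using ev1 ev2 ev3
      proof eventually_elim
        case (elim n)
        interpret loo_data \<Psi> p n "x n" "S n" by (rule loo[OF elim(2)])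
        have a: "a_L2 \<Psi> n (x n) \<ge> real n ^ 3 * \<delta>\<^sup>2 / 8"
          using a_L2_lower[of k] elim k by (simp add: \<delta>_def)
        have b: "b_L2 \<Psi> n (x n) \<le> 2 * (real n)\<^sup>2" by (rule b_L2_upper)
        have pos: "real n ^ 3 * \<delta>\<^sup>2 / 8 > 0" using \<delta> elim(2) by simp
        have ba: "b_L2 \<Psi> n (x n) \<le> a_L2 \<Psi> n (x n)" using a b elim(3) by linarith
        have "b_L2 \<Psi> n (x n) / a_L2 \<Psi> n (x n) \<le> 2 * (real n)\<^sup>2 / (real n ^ 3 * \<delta>\<^sup>2 / 8)"
          if "0 \<le> b_L2 \<Psi> n (x n)"
          using a b pos that by (intro frac_le) auto
        also have "2 * (real n)\<^sup>2 / (real n ^ 3 * \<delta>\<^sup>2 / 8) = 16 / (\<delta>\<^sup>2 * real n)"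
          using \<delta> elim(2) by (simp add: power2_eq_square power3_eq_cube field_simps)
        finally have le: "0 \<le> b_L2 \<Psi> n (x n) \<Longrightarrow> b_L2 \<Psi> n (x n) / a_L2 \<Psi> n (x n) \<le> 16 / (\<delta>\<^sup>2 * real n)" .
        show ?case
          using d ba a pos le \<delta> by (auto simp: mixture_param_def beta_L2_def Let_def)
      qed
      ultimately show ?thesis by (rule Lim_null_comparison[rotated])
    qed
    have "(\<lambda>n. stacked d \<Psi> n (x n) j - emp n (x n) j) \<longlonglongrightarrow> 0"
    proof (rule Lim_null_comparison[OF _ \<beta>])
      show "\<forall>\<^sub>F n in sequentially. norm (stacked d \<Psi> n (x n) j - emp n (x n) j) \<le> mixture_param d \<Psi> n (x n)"
        using ev2
      proof eventually_elim
        case (elim n)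
        interpret loo_data \<Psi> p n "x n" "S n" by (rule loo[OF elim])
        have "stacked d \<Psi> n (x n) j - emp n (x n) j = mixture_param d \<Psi> n (x n) * (\<Psi> (emp n (x n)) j - emp n (x n) j)"
          by (simp add: stacked_def algebra_simps)
        then show ?case
          using mixture_param_bounds(1)[of d \<Psi> n "x n"] prob_vectors_diff_le_1[OF maps[OF emp] emp, of j]
          by (simp add: abs_mult mult_left_le)
      qed
    qed
    from tendsto_add[OF this lim[of j]] show ?thesis by simp
  qed
qed

theorem theorem7:
  fixes M :: "'a measure"
    and s :: "nat \<Rightarrow> 's"
    and z :: "nat \<Rightarrow> 'a \<Rightarrow> 's"
    and p :: "nat \<Rightarrow> real"
    and \<Psi> :: "(nat \<Rightarrow> real) \<Rightarrow> nat \<Rightarrow> real"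
    and \<alpha> :: real
    and d :: nat
    and N :: "(nat \<Rightarrow> real) \<Rightarrow> 'b measure"
    and Y :: "(nat \<Rightarrow> real) \<Rightarrow> 'b \<Rightarrow> nat \<Rightarrow> real"
  assumes "prob_space M"
    and "inj s"
    and "p \<in> prob_vectors"
    and iid_indep: "prob_space.indep_vars M (\<lambda>_. count_space (range s)) z {1..}"
    and iid_law: "\<And>i j. i \<ge> 1 \<Longrightarrow> measure M {\<omega> \<in> space M. z i \<omega> = s j} = p j"
    and maps: "\<And>f. f \<in> prob_vectors \<Longrightarrow> \<Psi> f \<in> prob_vectors"
    and prop_i: "\<And>f \<epsilon>. f \<in> prob_vectors \<Longrightarrow> \<epsilon> > 0 \<Longrightarrow>
          \<exists>\<delta>>0. \<forall>h\<in>prob_vectors. lp_norm 2 (\<lambda>j. h j - f j) < \<delta> \<longrightarrow>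
            lp_norm 2 (\<lambda>j. \<Psi> h j - \<Psi> f j) < \<epsilon>"
    and prop_ii: "\<And>f h. f \<in> prob_vectors \<Longrightarrow> h \<in> prob_vectors \<Longrightarrow>
          lp_norm \<infinity> (\<lambda>j. \<Psi> f j - \<Psi> h j) \<le> lp_norm \<infinity> (\<lambda>j. f j - h j)"
    and prop_iii: "\<And>f. f \<in> prob_vectors \<Longrightarrow>
          ell2_inner (\<Psi> f) (\<lambda>j. f j - \<Psi> f j) = 0 \<and> ell2_inner f (\<lambda>j. f j - \<Psi> f j) \<ge> 0"
    and prop_iv: "\<exists>c :: nat \<Rightarrow> real. c \<longlonglongrightarrow> 1 \<and>
          (\<forall>n\<ge>2. \<forall>x. freq_data n x \<longrightarrow>
            (\<forall>j. c n * gamma_hat \<Psi> n x j \<le> \<Psi> (emp n x) j))"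
    and prop_v: "\<Psi> p = p \<Longrightarrow>
          (\<forall>k::ereal. 2 \<le> k \<longrightarrow>
            bigO_p M 0 (\<lambda>n \<omega>. sqrt (real n) * lp_norm k (\<lambda>j. \<Psi> (emp n (freq s z n \<omega>)) j - p j))) \<and>
          (summable (\<lambda>j. sqrt (p j)) \<longrightarrow>
            bigO_p M 0 (\<lambda>n \<omega>. sqrt (real n) * lp_norm 1 (\<lambda>j. \<Psi> (emp n (freq s z n \<omega>)) j - p j)))"
    and "0 < \<alpha>" and "\<alpha> < 1"
    and "d \<in> {1, 2}"
    and gauss: "\<And>f. f \<in> prob_vectors \<Longrightarrow> multinomial_gaussian f (N f) (Y f)"
  shows "AE \<omega> in M.
      (\<lambda>n. let \<phi> = stacked d \<Psi> n (freq s z n \<omega>)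
            in upper_quantile \<alpha> (N \<phi>) (\<lambda>\<eta>. lp_norm \<infinity> (Y \<phi> \<eta>)))
      \<longlonglongrightarrow> upper_quantile \<alpha> (N p) (\<lambda>\<eta>. lp_norm \<infinity> (Y p \<eta>))"
proof -
  interpret prob_space M by fact
  let ?x = "\<lambda>n \<omega>. freq s z n \<omega>"
  have range: "z i \<omega> \<in> range s" if "\<omega> \<in> space M" "i \<ge> 1" for i \<omega>
  proof -
    have "z i \<in> measurable M (count_space (range s))" using iid_indep that by (auto simp: indep_vars_def)
    then show ?thesis using that by (auto dest: measurable_space)
  qed
  have data: "freq_data n (?x n \<omega>)" if "\<omega> \<in> space M" for n \<omega>
    using that by (intro freq_data_freq \<open>inj s\<close> range) auto
  have "AE \<omega> in M. \<forall>j. (\<lambda>n. emp n (?x n \<omega>) j) \<longlonglongrightarrow> p j"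
    unfolding AE_all_countable
    by (intro allI frequencies_tendsto[OF \<open>prob_space M\<close> iid_indep] iid_law)
  with AE_space show ?thesis
  proof eventually_elim
    case (elim \<omega>)
    \<comment> \<open>The sample \<open>\<omega>\<close> is fixed from here on, so the stacked
      estimates form a deterministic sequence and the quantile theorem applies pathwise.\<close>
    have lim: "(\<lambda>n. stacked d \<Psi> n (?x n \<omega>) j) \<longlonglongrightarrow> p j" for j
      using prop_iii[OF \<open>p \<in> prob_vectors\<close>] elim
      by (intro stacked_tendsto[OF maps prop_ii _ \<open>p \<in> prob_vectors\<close> data]) auto
    \<comment> \<open>The index is shifted because at sample size 0 membership in
      \<open>prob_vectors\<close>, and with it a Gaussian element from \<open>gauss\<close>, is not
      guaranteed.\<close>
    have pv: "stacked d \<Psi> (Suc n) (?x (Suc n) \<omega>) \<in> prob_vectors" for n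
      unfolding stacked_def using emp_prob_vector[OF data[OF elim(1)], of "Suc n"]
      by (intro prob_vectors_convex maps mixture_param_bounds) auto
    have "(\<lambda>n. let \<phi> = stacked d \<Psi> (Suc n) (?x (Suc n) \<omega>)
            in upper_quantile \<alpha> (N \<phi>) (\<lambda>\<eta>. lp_norm \<infinity> (Y \<phi> \<eta>)))
      \<longlonglongrightarrow> upper_quantile \<alpha> (N p) (\<lambda>\<eta>. lp_norm \<infinity> (Y p \<eta>))"
      unfolding Let_def
      by (rule multinomial_gaussian_quantile_tendsto[OF gauss[OF pv] gauss[OF \<open>p \<in> prob_vectors\<close>] pv
            \<open>p \<in> prob_vectors\<close> LIMSEQ_Suc[OF lim] \<open>0 < \<alpha>\<close> \<open>\<alpha> < 1\<close>])
    then show ?case by (rule LIMSEQ_imp_Suc)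
  qed
qed

end
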